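(* Consider the Gaussian sequence model $Y_{lk}=\beta^0_{lk}+\varepsilon_{lk}/\sqrt n$, $\varepsilon_{lk}$ i.i.d. $\mathcal N(0,1)$, with $\beta^0_{lk}=\int_0^1f_0\psi_{lk}$ the Haar coefficients of $f_0$, and let $\Pi$ be a spike-and-slab prior on $\{\beta_{lk}\}$ satisfying the prior assumption given in the context. Let $t,M,\eta:[0,1]\to(0,\infty)$ be such that $M(\cdot),\eta(\cdot)$ are bounded and uniformly bounded away from zero and $0<t_1\le\inf_xt(x)$, $t(\cdot)\le1$. Then for all sufficiently large constants $\widetilde M>0$, $$\sup_{f_0\in\mathcal C(t,M,\eta)}E_{f_0}\,\Pi\Big[f:\ \sup_{x\in[0,1]}\zeta_n(x)|f(x)-f_0(x)|>\widetilde M\,\Big|\,Y\Big]\to0\quad(n\to\infty),$$ where $\zeta_n(x)=(n/\log n)^{t(x)/(2t(x)+1)}$ and $f=\sum_{l,k}\beta_{lk}\psi_{lk}$.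
   Context: Haar system: $\psi_{-1,0}=\mathbb I_{[0,1]}$ and, for $l\ge0$, $0\le k<2^l$, $\psi_{lk}(x)=2^{l/2}\psi(2^lx-k)$ with $\psi=\mathbb I_{(0,1/2]}-\mathbb I_{(1/2,1]}$. Convention: $\psi_{l0}(0)=2^{l/2}$. Indices $(l,k)$ range over $(-1,0)$ and $l\ge0$, $0\le k<2^l$. Local Hölder class: $\mathcal C(t,M,\eta)$ is the set of $f:[0,1]\to\mathbb R$ such that for every $x\in[0,1]$, $\max\big(\|f\|_\infty,\ \sup_{0<|m|\le\eta(x),\,x+m\in[0,1]}|f(x+m)-f(x)|/|m|^{t(x)}\big)\le M(x)$. Prior assumption (spike-and-slab), with $L_{max}=\lfloor\log_2n\rfloor$: (a) a prior is put on subsets $\mathcal T\subseteq\{(l,k):l\le L_{max}\}$ such that, for constants $c_T,C_T>0$, $c_T\,\omega_l\le\Pi(\mathcal T\cup\{(l,k)\})/\Pi(\mathcal T)\le C_T\,\omega_l$ for all $\mathcal T$ and $(l,k)\notin\mathcal T$, where $\omega_l>0$ satisfies, for some constants $B_\omega>0$, $\delta>0$, $n^{-B_\omega}\le\omega_l\le n^{(1-\delta)/2}2^{-l}$ for all $l\le L_{max}$; (b) given $\mathcal T$, the $\beta_{lk}$, $(l,k)\in\mathcal T$, are independent with densities $\pi_{lk}$ on $\mathbb R$, and $\beta_{lk}=0$ for $(l,k)\notin\mathcal T$; there exist constants $R,c_R,C_R>0$ such that $c_R\le\inf_{|\beta|\le R}\pi_{lk}(\beta)\le\sup_{\beta\in\mathbb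 R}\pi_{lk}(\beta)\le C_R$ for all $(l,k)$. The constants $c_T,C_T,B_\omega,\delta,R,c_R,C_R$ do not depend on $n$.
   Formalization: Adds the hypothesis that the Haar coefficients of every f_0 in C(t,M,η) lie in [-R,R], where the slab densities are bounded below; without it slabs uniform on [-R,R] and a constant f_0 in (R,M) refute the claim. *)

theory Defs
  imports "HOL-Probability.Probability"
begin

section \<open>Haar system\<close>

text \<open>Indices are pairs \<open>(l, k)\<close> with \<open>l \<ge> -1\<close>; the pair \<open>(-1, 0)\<close> is the constant function.\<close>

definition haar_idx :: "(int \<times> nat) set" where
  "haar_idx = insert (-1, 0) {(l, k). 0 \<le> l \<and> k < 2 ^ nat l}"

definition haar_mother :: "real \<Rightarrow> real" where
  "haar_mother x = indicator {0<..1/2} x - indicator {1/2<..1} x"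

definition haar :: "int \<times> nat \<Rightarrow> real \<Rightarrow> real" where
  "haar = (\<lambda>(l, k) x.
     if l = -1 then indicator {0..1} x
     else if k = 0 \<and> x = 0 then 2 powr (l / 2)
     else 2 powr (l / 2) * haar_mother (2 ^ nat l * x - real k))"

definition haar_coeff :: "(real \<Rightarrow> real) \<Rightarrow> int \<times> nat \<Rightarrow> real" where
  "haar_coeff f i = (LINT x:{0..1}|lborel. f x * haar i x)"

definition L_max :: "nat \<Rightarrow> int" where
  "L_max n = \<lfloor>log 2 (real n)\<rfloor>"

definition idx_upto :: "nat \<Rightarrow> (int \<times> nat) set" where
  "idx_upto n = {i \<in> haar_idx. fst i \<le> L_max n}"

definition haar_sum :: "nat \<Rightarrow> (int \<times> nat \<Rightarrow> real) \<Rightarrow> real \<Rightarrow> real" where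
  "haar_sum n \<beta> x = (\<Sum>i\<in>idx_upto n. \<beta> i * haar i x)"

section \<open>Local Hoelder class\<close>

text \<open>Only the values on \<open>[0, 1]\<close> matter. The maximum of the sup norm and the local Hoelder
  quotients is at most \<open>M x\<close> iff each of them is, so the suprema are written out.\<close>

definition local_holder ::
  "(real \<Rightarrow> real) \<Rightarrow> (real \<Rightarrow> real) \<Rightarrow> (real \<Rightarrow> real) \<Rightarrow> (real \<Rightarrow> real) set" where
  "local_holder t M \<eta> = {f. \<forall>x\<in>{0..1}.
     (\<forall>y\<in>{0..1}. \<bar>f y\<bar> \<le> M x) \<and>
     (\<forall>m. 0 < \<bar>m\<bar> \<and> \<bar>m\<bar> \<le> \<eta> x \<and> x + m \<in> {0..1} \<longrightarrow>
        \<bar>f (x + m) - f x\<bar> / \<bar>m\<bar> powr t x \<le> M x)}"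

definition rate :: "nat \<Rightarrow> real \<Rightarrow> real" where
  "rate n s = (real n / ln (real n)) powr (s / (2 * s + 1))"

section \<open>Gaussian sequence model\<close>

definition noise :: "(int \<times> nat \<Rightarrow> real) measure" where
  "noise = (\<Pi>\<^sub>M i\<in>haar_idx. density lborel std_normal_density)"

definition data_law :: "nat \<Rightarrow> (int \<times> nat \<Rightarrow> real) \<Rightarrow> (int \<times> nat \<Rightarrow> real) measure" where
  "data_law n \<beta>0 = distr noise (\<Pi>\<^sub>M i\<in>haar_idx. borel)
     (\<lambda>\<epsilon>. \<lambda>i\<in>haar_idx. \<beta>0 i + \<epsilon> i / sqrt (real n))"

section \<open>Spike-and-slab prior and posterior\<close>

text \<open>All coefficients beyond level \<open>L_max n\<close> vanish under the prior, so it is a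
  measure on the coefficients indexed by \<open>idx_upto n\<close>.\<close>

definition spike_slab ::
  "nat \<Rightarrow> (int \<times> nat) set pmf \<Rightarrow> (int \<times> nat \<Rightarrow> real \<Rightarrow> real) \<Rightarrow> (int \<times> nat \<Rightarrow> real) measure" where
  "spike_slab n p \<pi> = measure_pmf p \<bind>
     (\<lambda>T. \<Pi>\<^sub>M i\<in>idx_upto n. if i \<in> T then density lborel (\<pi> i) else return borel 0)"

definition spike_slab_assumption ::
  "nat \<Rightarrow> (int \<times> nat) set pmf \<Rightarrow> (int \<Rightarrow> real) \<Rightarrow> (int \<times> nat \<Rightarrow> real \<Rightarrow> real) \<Rightarrow>
   real \<Rightarrow> real \<Rightarrow> real \<Rightarrow> real \<Rightarrow> real \<Rightarrow> real \<Rightarrow> real \<Rightarrow> bool" where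
  "spike_slab_assumption n p \<omega> \<pi> c_T C_T B_\<omega> \<delta> R c_R C_R \<longleftrightarrow>
     set_pmf p \<subseteq> Pow (idx_upto n) \<and>
     (\<forall>T l k. T \<subseteq> idx_upto n \<and> (l, k) \<in> idx_upto n - T \<longrightarrow>
        0 < pmf p T \<and>
        c_T * \<omega> l \<le> pmf p (T \<union> {(l, k)}) / pmf p T \<and>
        pmf p (T \<union> {(l, k)}) / pmf p T \<le> C_T * \<omega> l) \<and>
     (\<forall>l. -1 \<le> l \<and> l \<le> L_max n \<longrightarrow>
        0 < \<omega> l \<and>
        real n powr (- B_\<omega>) \<le> \<omega> l \<and>
        \<omega> l \<le> real n powr ((1 - \<delta>) / 2) * 2 powr (- real_of_int l)) \<and>
     (\<forall>i\<in>idx_upto n.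
        \<pi> i \<in> borel_measurable borel \<and>
        (\<forall>b. 0 \<le> \<pi> i b) \<and>
        prob_space (density lborel (\<pi> i)) \<and>
        (\<forall>b. \<bar>b\<bar> \<le> R \<longrightarrow> c_R \<le> \<pi> i b) \<and>
        (\<forall>b. \<pi> i b \<le> C_R))"

text \<open>Density of the observations up to level \<open>L_max n\<close>. Every parameter in the support of the
  prior gives the remaining observations the same law \<open>N(0, 1/n)\<close>, so they cancel in Bayes'
  formula.\<close>

definition likelihood ::
  "nat \<Rightarrow> (int \<times> nat \<Rightarrow> real) \<Rightarrow> (int \<times> nat \<Rightarrow> real) \<Rightarrow> real" where
  "likelihood n Y \<beta> = (\<Prod>i\<in>idx_upto n. normal_density (\<beta> i) (1 / sqrt (real n)) (Y i))"

definition posterior ::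
  "nat \<Rightarrow> (int \<times> nat \<Rightarrow> real) measure \<Rightarrow> (int \<times> nat \<Rightarrow> real) \<Rightarrow> (int \<times> nat \<Rightarrow> real) measure" where
  "posterior n P Y =
     density P (\<lambda>\<beta>. ennreal (likelihood n Y \<beta> / (\<integral>b. likelihood n Y b \<partial>P)))"

end

theory Submission
  imports Defs "HOL-Real_Asymp.Real_Asymp"
begin

text \<open>Let \<open>r = sqrt (log n / n)\<close>. For small \<open>a\<close> and large \<open>A\<close>, with posterior probability tending to one
  every coefficient with \<open>\<bar>\<beta>\<^sup>0\<bar> \<le> a r\<close> is set to zero and every other one is within \<open>A r\<close> of its true
  value. To bound the posterior probability that coordinate \<open>i\<close> fails, pair the models \<open>T\<close> and
  \<open>T \<union> {i}\<close>: only the one-dimensional marginal likelihoods of \<open>Y i\<close> with and without the slab remain,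
  and a union bound over the at most \<open>2 n\<close> indices suffices. The Bayes factor of a spurious inclusion,
  of order \<open>\<omega> exp (n Y\<^sup>2 / 2) / sqrt n\<close>, has a finite expectation only after restricting
  the noise to \<open>\<bar>\<epsilon>\<bar> \<le> 3 sqrt (log n)\<close>.

  On this event the error at \<open>x\<close> is a sum over levels. Hoelder continuity at \<open>x\<close> alone bounds the true
  coefficients of the intervals containing \<open>x\<close>, so the level \<open>l\<close> term is at most a constant times
  \<open>2 powr (l / 2) * min r (2 powr (- l * (t x + 1 / 2)))\<close>, and these terms decay geometrically away
  from the level where both entries of the minimum agree. The tail beyond \<open>L_max n\<close> is the difference
  between \<open>f\<^sub>0 x\<close> and the average of \<open>f\<^sub>0\<close> over a dyadic interval of length at most \<open>1 / n\<close>.\<close>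

section \<open>Dyadic intervals and Haar partial sums\<close>

text \<open>The point \<open>0\<close> belongs to the leftmost interval, in accordance with the convention for
  \<open>\<psi>\<^sub>l\<^sub>0(0)\<close>, so that the formula for the wavelets holds at every point.\<close>

definition dyadic :: "nat \<Rightarrow> nat \<Rightarrow> real set" where
  "dyadic l k = {x. real k / 2 ^ l < x \<and> x \<le> (real k + 1) / 2 ^ l \<or> x = 0 \<and> k = 0}"

lemma mem_dyadic_iff:
  "x \<in> dyadic l k \<longleftrightarrow> real k < 2 ^ l * x \<and> 2 ^ l * x \<le> real k + 1 \<or> x = 0 \<and> k = 0"
  by (auto simp: dyadic_def field_simps)

lemma dyadic_unique:
  assumes "x \<in> dyadic l j" "x \<in> dyadic l k" shows "j = k"
  using assms by (auto simp: mem_dyadic_iff)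

lemma dyadic_Suc:
  "dyadic (Suc l) (2 * k) = {x \<in> dyadic l k. 2 ^ l * x \<le> real k + 1 / 2}"
  "dyadic (Suc l) (2 * k + 1) = {x \<in> dyadic l k. 2 ^ l * x > real k + 1 / 2}"
  by (auto simp: mem_dyadic_iff)

lemma dyadic_0: "dyadic 0 0 = {0..1}"
  by (auto simp: mem_dyadic_iff)

lemma dyadic_subset_div2: "dyadic (Suc l) k \<subseteq> dyadic l (k div 2)"
proof (cases "even k")
  case True
  then obtain j where "k = 2 * j" by (auto elim: evenE)
  then show ?thesis using dyadic_Suc(1)[of l j] by auto
next
  case False
  then obtain j where "k = 2 * j + 1" by (auto elim: oddE)
  then show ?thesis using dyadic_Suc(2)[of l j] by auto
qed

lemma dyadic_split:
  "dyadic l k = dyadic (Suc l) (2 * k) \<union> dyadic (Suc l) (2 * k + 1)"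
  "dyadic (Suc l) (2 * k) \<inter> dyadic (Suc l) (2 * k + 1) = {}"
  unfolding dyadic_Suc by auto

lemma dyadic_subset_unit:
  assumes "k < 2 ^ l" shows "dyadic l k \<subseteq> {0..1}"
proof
  fix x assume x: "x \<in> dyadic l k"
  have k: "real k + 1 \<le> 2 ^ l"
    using assms by (metis Suc_leI add.commute of_nat_Suc of_nat_le_iff of_nat_numeral of_nat_power)
  from x consider "real k < 2 ^ l * x" "2 ^ l * x \<le> real k + 1" | "x = 0"
    by (auto simp: mem_dyadic_iff)
  then show "x \<in> {0..1}"
  proof cases
    case 1
    have "0 < 2 ^ l * x" "2 ^ l * x \<le> 2 ^ l * 1" using 1 k by linarith+
    then show ?thesis by (simp add: zero_less_mult_iff)
  qed auto
qed

lemma ex_dyadic: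
  assumes "x \<in> {0..1}" obtains k where "k < 2 ^ l" "x \<in> dyadic l k"
proof (cases "x = 0")
  case True
  then show ?thesis using that[of 0] by (simp add: mem_dyadic_iff)
next
  case False
  then have x: "0 < x" "x \<le> 1" using assms by auto
  \<comment> \<open>The intervals are half-open on the left, so a positive \<open>x\<close> gets the
    index one below the ceiling of \<open>2 ^ l * x\<close>.\<close>
  define z where "z = \<lceil>2 ^ l * x\<rceil>"
  have z: "2 ^ l * x \<le> real_of_int z" "real_of_int z < 2 ^ l * x + 1"
    unfolding z_def by linarith+
  have "0 < 2 ^ l * x" using x by simp
  then have z0: "0 < z" using z by linarith
  have "2 ^ l * x \<le> real_of_int (2 ^ l)" using x by simp
  then have z1: "z \<le> 2 ^ l" unfolding z_def by (simp add: ceiling_le_iff)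
  have k: "real (nat (z - 1)) = real_of_int z - 1" using z0 by simp
  show ?thesis
  proof (rule that[of "nat (z - 1)"])
    show "nat (z - 1) < 2 ^ l" using z0 z1
      by (metis linorder_not_less nat_less_iff of_nat_numeral of_nat_power zle_diff1_eq)
    show "x \<in> dyadic l (nat (z - 1))" using z k by (auto simp: mem_dyadic_iff)
  qed
qed

lemma dyadic_eq_interval:
  "dyadic l k = (if k = 0 then {0..1 / 2 ^ l} else {real k / 2 ^ l<..(real k + 1) / 2 ^ l})"
proof (cases "k = 0")
  case True
  then show ?thesis by (auto simp: dyadic_def)
next
  case False
  then show ?thesis by (auto simp: dyadic_def)
qed

lemma sets_dyadic [measurable]: "dyadic l k \<in> sets borel"
  by (auto simp: dyadic_eq_interval)

lemma measure_dyadic: "measure lborel (dyadic l k) = 1 / 2 ^ l"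
  and emeasure_dyadic: "emeasure lborel (dyadic l k) = ennreal (1 / 2 ^ l)"
  by (auto simp: dyadic_eq_interval field_simps)

lemma dyadic_diameter:
  assumes "x \<in> dyadic l k" "y \<in> dyadic l k" shows "\<bar>x - y\<bar> \<le> 1 / 2 ^ l"
proof -
  have "dyadic l k \<subseteq> {real k / 2 ^ l..(real k + 1) / 2 ^ l}"
    by (auto simp: dyadic_def)
  then have "real k / 2 ^ l \<le> x" "x \<le> (real k + 1) / 2 ^ l" "real k / 2 ^ l \<le> y" "y \<le> (real k + 1) / 2 ^ l"
    using assms by auto
  moreover have "(real k + 1) / 2 ^ l - real k / 2 ^ l = 1 / 2 ^ l"
    by (simp add: field_simps)
  ultimately show ?thesis by linarith
qed

lemma haar_eq_dyadic:
  "haar (int l, k) x = 2 powr (real l / 2) *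
     (indicator (dyadic (Suc l) (2 * k)) x - indicator (dyadic (Suc l) (2 * k + 1)) x)"
  by (auto simp: haar_def haar_mother_def indicator_def dyadic_Suc mem_dyadic_iff)

lemma haar_eq_0: "x \<notin> dyadic l k \<Longrightarrow> haar (int l, k) x = 0"
  unfolding haar_eq_dyadic dyadic_Suc by auto

lemma abs_haar: "x \<in> dyadic l k \<Longrightarrow> \<bar>haar (int l, k) x\<bar> = 2 powr (real l / 2)"
  unfolding haar_eq_dyadic dyadic_Suc by (auto simp: indicator_def)

text \<open>Dyadic intervals of one level are disjoint, so at a given point only one wavelet per
  level is nonzero.\<close>

lemma sum_haar_level:
  assumes "x \<in> dyadic l k" "k < 2 ^ l"
  shows "(\<Sum>j<2 ^ l. g j * haar (int l, j) x) = g k * haar (int l, k) x"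
proof -
  have "(\<Sum>j<2 ^ l. g j * haar (int l, j) x) = (\<Sum>j\<in>{k}. g j * haar (int l, j) x)"
  proof (rule sum.mono_neutral_right)
    show "\<forall>j\<in>{..<2 ^ l} - {k}. g j * haar (int l, j) x = 0"
      using dyadic_unique[OF assms(1)] haar_eq_0[of x l] by (metis DiffD2 mult_zero_right singletonI)
  qed (use assms in auto)
  then show ?thesis by simp
qed

lemma haar_coeff_eq:
  assumes f: "set_integrable lborel {0..1} f" and k: "k < 2 ^ l"
  shows "haar_coeff f (int l, k) = 2 powr (real l / 2) *
    ((LINT y:dyadic (Suc l) (2 * k)|lborel. f y) - (LINT y:dyadic (Suc l) (2 * k + 1)|lborel. f y))"
proof -
  have sub: "dyadic (Suc l) (2 * k) \<subseteq> {0..1}" "dyadic (Suc l) (2 * k + 1) \<subseteq> {0..1}"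
    using dyadic_subset_unit[OF k] dyadic_split(1)[of l k] by auto
  have int: "set_integrable lborel (dyadic (Suc l) (2 * k)) f"
      "set_integrable lborel (dyadic (Suc l) (2 * k + 1)) f"
    using sub by (auto intro: set_integrable_subset[OF f])
  have "haar_coeff f (int l, k) = (\<integral>y. 2 powr (real l / 2) *
      (indicator (dyadic (Suc l) (2 * k)) y *\<^sub>R f y - indicator (dyadic (Suc l) (2 * k + 1)) y *\<^sub>R f y) \<partial>lborel)"
    unfolding haar_coeff_def set_lebesgue_integral_def
  proof (rule Bochner_Integration.integral_cong)
    fix y :: real
    show "indicator {0..1} y *\<^sub>R (f y * haar (int l, k) y) = 2 powr (real l / 2) *
      (indicator (dyadic (Suc l) (2 * k)) y *\<^sub>R f y - indicator (dyadic (Suc l) (2 * k + 1)) y *\<^sub>R f y)"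
      using subsetD[OF sub(1), of y] subsetD[OF sub(2), of y] unfolding haar_eq_dyadic
      by (auto simp: indicator_def)
  qed simp
  also have "\<dots> = 2 powr (real l / 2) *
    ((LINT y:dyadic (Suc l) (2 * k)|lborel. f y) - (LINT y:dyadic (Suc l) (2 * k + 1)|lborel. f y))"
    using int unfolding set_lebesgue_integral_def set_integrable_def by simp
  finally show ?thesis .
qed

lemma haar_coeff_const: "haar_coeff f (- 1, 0) = (LINT y:dyadic 0 0|lborel. f y)"
  unfolding haar_coeff_def dyadic_0 set_lebesgue_integral_def
  by (rule Bochner_Integration.integral_cong) (auto simp: haar_def indicator_def)

text \<open>A Haar partial sum at \<open>x\<close> is the mean of \<open>f\<close> over the dyadic
  interval around \<open>x\<close>: adding one level replaces this mean by the mean over the half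
  containing \<open>x\<close>. The truncation bias thereby becomes an oscillation of
  \<open>f\<close> near \<open>x\<close>.\<close>

lemma haar_partial_sum:
  assumes f: "set_integrable lborel {0..1} f" and "k < 2 ^ L" "x \<in> dyadic L k"
  shows "haar_coeff f (- 1, 0) * haar (- 1, 0) x +
     (\<Sum>l<L. \<Sum>j<2 ^ l. haar_coeff f (int l, j) * haar (int l, j) x) =
     2 ^ L * (LINT y:dyadic L k|lborel. f y)"
  using assms(2,3)
proof (induction L arbitrary: k)
  case 0
  then have "haar (- 1, 0) x = 1" using dyadic_0 by (auto simp: haar_def)
  with 0 show ?case by (simp add: haar_coeff_const)
next
  case (Suc L)
  define j where "j = k div 2"
  have j: "j < 2 ^ L" "x \<in> dyadic L j"
    using Suc.prems dyadic_subset_div2[of L k] by (auto simp: j_def)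
  let ?S = "\<lambda>l k. LINT y:dyadic l k|lborel. f y"
  have sub: "dyadic (Suc L) (2 * j) \<subseteq> {0..1}" "dyadic (Suc L) (2 * j + 1) \<subseteq> {0..1}"
    using dyadic_subset_unit[OF j(1)] dyadic_split(1)[of L j] by auto
  have int: "set_integrable lborel (dyadic (Suc L) (2 * j)) f"
      "set_integrable lborel (dyadic (Suc L) (2 * j + 1)) f"
    using sub by (auto intro: set_integrable_subset[OF f])
  have S: "?S L j = ?S (Suc L) (2 * j) + ?S (Suc L) (2 * j + 1)"
    using int dyadic_split(1)[of L j] dyadic_split(2)[of L j] by (simp add: set_integral_Un)
  have pw: "2 powr (real L / 2) * 2 powr (real L / 2) = 2 ^ L"
    by (simp add: powr_add[symmetric] powr_realpow)
  have kj: "k = 2 * j \<or> k = 2 * j + 1" unfolding j_def by linarith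
  \<comment> \<open>With \<open>S0\<close> and \<open>S1\<close> the integrals over the left and
    right half, the left-hand side is \<open>2 ^ L * (S0 + S1)\<close> plus or minus
    \<open>2 ^ L * (S0 - S1)\<close>. The sign of the wavelet at \<open>x\<close> selects twice the
    half containing \<open>x\<close>.\<close>
  have "2 ^ L * ?S L j + haar_coeff f (int L, j) * haar (int L, j) x = 2 ^ Suc L * ?S (Suc L) k"
    using kj
  proof
    assume k: "k = 2 * j"
    have "x \<notin> dyadic (Suc L) (2 * j + 1)" using Suc.prems k dyadic_split(2)[of L j] by auto
    then have "haar (int L, j) x = 2 powr (real L / 2)"
      using Suc.prems k unfolding haar_eq_dyadic by simp
    then show ?thesis unfolding haar_coeff_eq[OF f j(1)] S pw[symmetric] power_Suc k
      by (simp add: algebra_simps)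
  next
    assume k: "k = 2 * j + 1"
    have "x \<notin> dyadic (Suc L) (2 * j)" using Suc.prems k dyadic_split(2)[of L j] by auto
    then have "haar (int L, j) x = - (2 powr (real L / 2))"
      using Suc.prems k unfolding haar_eq_dyadic by simp
    then show ?thesis unfolding haar_coeff_eq[OF f j(1)] S pw[symmetric] power_Suc k
      by (simp add: algebra_simps)
  qed
  then show ?case using Suc.IH[OF j] by (simp add: sum_haar_level[OF j(2,1)])
qed

text \<open>The interval has length \<open>1 / 2 ^ l\<close>, so \<open>c / 2 ^ l\<close> is the
  integral of the constant \<open>c\<close>. The bound is applied with \<open>c = f x\<close>, both
  to wavelet coefficients and to the truncation bias.\<close>

lemma dyadic_average_error:
  fixes f :: "real \<Rightarrow> real"
  assumes f: "set_integrable lborel {0..1} f" and k: "k < 2 ^ l"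
    and b: "\<And>y. y \<in> dyadic l k \<Longrightarrow> \<bar>f y - c\<bar> \<le> e"
  shows "\<bar>(LINT y:dyadic l k|lborel. f y) - c / 2 ^ l\<bar> \<le> e / 2 ^ l"
proof -
  have int: "set_integrable lborel (dyadic l k) f"
    by (rule set_integrable_subset[OF f]) (use dyadic_subset_unit[OF k] in auto)
  have c: "set_integrable lborel (dyadic l k) (\<lambda>y. d)" for d :: real
    unfolding set_integrable_def by (auto simp: emeasure_dyadic intro: integrable_real_indicator)
  have lc: "(LINT y:dyadic l k|lborel. d) = d / 2 ^ l" for d :: real
    unfolding set_lebesgue_integral_def by (simp add: measure_dyadic)
  have "\<bar>(LINT y:dyadic l k|lborel. f y) - c / 2 ^ l\<bar> = \<bar>LINT y:dyadic l k|lborel. f y - c\<bar>"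
    using set_integral_diff(2)[OF int c[of c]] lc by simp
  also have "\<dots> \<le> (LINT y:dyadic l k|lborel. \<bar>f y - c\<bar>)"
    using set_integral_norm_bound[OF set_integral_diff(1)[OF int c[of c]]] by simp
  also have "\<dots> \<le> (LINT y:dyadic l k|lborel. e)"
    by (rule set_integral_mono) (use b c set_integrable_abs[OF set_integral_diff(1)[OF int c[of c]]] in auto)
  finally show ?thesis by (simp add: lc)
qed

section \<open>The finite index set up to the truncation level\<close>

lemma idx_upto_eq:
  assumes "n \<ge> 1" and L: "L = nat (L_max n)"
  shows "idx_upto n = insert (- 1, 0) ((\<lambda>(l, k). (int l, k)) ` (SIGMA l:{..<Suc L}. {..<2 ^ l}))"
    and "real (2 ^ L) \<le> real n" and "real n < 2 ^ Suc L" and "L_max n = int L"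
proof -
  have l0: "0 \<le> log 2 (real n)" using assms(1) by simp
  have Lm: "L_max n = int L" using l0 L by (simp add: L_max_def)
  then show "L_max n = int L" .
  \<comment> \<open>The two sides of the floor serve different purposes:
    \<open>2 ^ L \<le> n\<close> bounds the number of indices by \<open>2 * n\<close>, and
    \<open>n < 2 ^ Suc L\<close> makes the intervals just beyond the last level shorter than
    \<open>1 / n\<close>.\<close>
  have "real L \<le> log 2 n" "log 2 n < real (Suc L)"
    using Lm unfolding L_max_def by linarith+
  then show "real (2 ^ L) \<le> real n" "real n < 2 ^ Suc L"
    using assms(1) by (simp_all add: le_log_iff log_less_iff powr_realpow powr_add)
  show "idx_upto n = insert (- 1, 0) ((\<lambda>(l, k). (int l, k)) ` (SIGMA l:{..<Suc L}. {..<2 ^ l}))"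
  proof (intro set_eqI iffI)
    fix i assume "i \<in> idx_upto n"
    then obtain l k where i: "i = (l, k)" "l = -1 \<and> k = 0 \<or> 0 \<le> l \<and> k < 2 ^ nat l" "l \<le> int L"
      by (auto simp: idx_upto_def haar_idx_def Lm)
    show "i \<in> insert (- 1, 0) ((\<lambda>(l, k). (int l, k)) ` (SIGMA l:{..<Suc L}. {..<2 ^ l}))"
    proof (cases "l = -1")
      case False
      then have "i = (\<lambda>(l, k). (int l, k)) (nat l, k)" "(nat l, k) \<in> (SIGMA l:{..<Suc L}. {..<2 ^ l})"
        using i by auto
      then show ?thesis by blast
    qed (use i in auto)
  qed (auto simp: idx_upto_def haar_idx_def Lm)
qed

lemma finite_idx_upto: "n \<ge> 1 \<Longrightarrow> finite (idx_upto n)"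
  by (subst idx_upto_eq(1)[OF _ refl]) auto

lemma sum_idx_upto:
  fixes g :: "int \<times> nat \<Rightarrow> real"
  assumes "n \<ge> 1" and L: "L = nat (L_max n)"
  shows "(\<Sum>i\<in>idx_upto n. g i) = g (- 1, 0) + (\<Sum>l<Suc L. \<Sum>k<2 ^ l. g (int l, k))"
proof -
  have "(\<Sum>i\<in>idx_upto n. g i) = g (- 1, 0) +
      (\<Sum>i\<in>(\<lambda>(l, k). (int l, k)) ` (SIGMA l:{..<Suc L}. {..<2 ^ l}). g i)"
    unfolding idx_upto_eq(1)[OF assms] by (subst sum.insert) auto
  also have "(\<Sum>i\<in>(\<lambda>(l, k). (int l, k)) ` (SIGMA l:{..<Suc L}. {..<2 ^ l}). g i) =
      (\<Sum>(l, k)\<in>(SIGMA l:{..<Suc L}. {..<2 ^ l}). g (int l, k))"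
    by (subst sum.reindex) (auto simp: inj_on_def intro!: sum.cong)
  also have "\<dots> = (\<Sum>l<Suc L. \<Sum>k<2 ^ l. g (int l, k))"
    by (subst sum.Sigma) auto
  finally show ?thesis .
qed

section \<open>The sup-norm error for well-estimated coefficients\<close>

text \<open>Distinct exponents select part of the full geometric series.\<close>

lemma sum_geometric_inj_le:
  fixes q :: real
  assumes "0 < q" "q < 1" "finite A" "inj_on h A"
  shows "(\<Sum>l\<in>A. q ^ h l) \<le> 1 / (1 - q)"
proof -
  have "(\<Sum>l\<in>A. q ^ h l) = (\<Sum>j\<in>h ` A. q ^ j)"
    using assms by (simp add: sum.reindex)
  also have "\<dots> \<le> (\<Sum>j. q ^ j)"
    using assms by (intro sum_le_suminf) (auto intro: summable_geometric)
  finally show ?thesis using assms by (simp add: suminf_geometric)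
qed

text \<open>Split at \<open>m\<close>, the floor of \<open>x\<close>. The distance from
  \<open>l\<close> to \<open>x\<close> is at least \<open>m - l\<close> for \<open>l \<le> m\<close>
  and at least \<open>l - Suc m\<close> for \<open>l > m\<close>, so each side is dominated by one
  geometric series, whatever \<open>L\<close> and \<open>x\<close> are.\<close>

lemma sum_powr_abs_diff_le:
  fixes x \<tau> :: real
  assumes "0 < \<tau>" "0 \<le> x"
  shows "(\<Sum>l<L. 2 powr (- \<tau> * \<bar>real l - x\<bar>)) \<le> 2 / (1 - 2 powr (- \<tau>))"
proof -
  define m where "m = nat \<lfloor>x\<rfloor>"
  define q where "q = 2 powr (- \<tau>)"
  have q: "0 < q" "q < 1" using assms by (auto simp: q_def powr_less_one)
  have m: "real m \<le> x" "x < real m + 1" using assms unfolding m_def by linarith+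
  have qp: "q ^ j = 2 powr (- \<tau> * real j)" for j
    by (simp add: q_def powr_powr powr_realpow[symmetric])
  have "(\<Sum>l<L. 2 powr (- \<tau> * \<bar>real l - x\<bar>)) \<le>
      (\<Sum>l\<in>{..<L} \<inter> {..m} \<union> {..<L} \<inter> {m<..}. 2 powr (- \<tau> * \<bar>real l - x\<bar>))"
    by (rule eq_refl, rule sum.cong) auto
  also have "\<dots> = (\<Sum>l\<in>{..<L} \<inter> {..m}. 2 powr (- \<tau> * \<bar>real l - x\<bar>)) +
      (\<Sum>l\<in>{..<L} \<inter> {m<..}. 2 powr (- \<tau> * \<bar>real l - x\<bar>))"
    by (rule sum.union_disjoint) auto
  also have "\<dots> \<le> (\<Sum>l\<in>{..<L} \<inter> {..m}. q ^ (m - l)) + (\<Sum>l\<in>{..<L} \<inter> {m<..}. q ^ (l - Suc m))"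
    unfolding qp using m assms(1)
    by (intro add_mono sum_mono powr_mono) (auto simp: of_nat_diff)
  also have "\<dots> \<le> 1 / (1 - q) + 1 / (1 - q)"
    using q by (intro add_mono sum_geometric_inj_le) (auto simp: inj_on_def)
  finally show ?thesis by (simp add: q_def)
qed

text \<open>The two entries of the minimum balance at level \<open>x = log 2 N / (2 s + 1)\<close>, and the summands
  decay geometrically away from that level.\<close>

lemma sum_min_rate_le:
  fixes N s \<tau> :: real
  assumes "1 \<le> N" "0 < \<tau>" "\<tau> \<le> s" "\<tau> \<le> 1 / 2"
  shows "(\<Sum>l<L. 2 powr (real l / 2) * min (N powr (- 1 / 2)) (2 powr (- real l * (s + 1 / 2))))
    \<le> 2 / (1 - 2 powr (- \<tau>)) * N powr (- s / (2 * s + 1))"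
proof -
  define x where "x = log 2 N / (2 * s + 1)"
  have s: "0 < 2 * s + 1" using assms by linarith
  have x: "0 \<le> x" using assms s by (simp add: x_def)
  have N: "N = 2 powr (x * (2 * s + 1))" using assms s by (simp add: x_def)
  have N1: "N powr (- 1 / 2) = 2 powr (- x * (s + 1 / 2))"
    unfolding N powr_powr by (rule arg_cong[where f = "(powr) 2"]) (simp add: field_simps)
  have N2: "N powr (- s / (2 * s + 1)) = 2 powr (- x * s)"
    unfolding N powr_powr using s by (intro arg_cong[where f = "(powr) 2"]) (simp add: field_simps)
  have "2 powr (real l / 2) * min (N powr (- 1 / 2)) (2 powr (- real l * (s + 1 / 2)))
      \<le> 2 powr (- x * s) * 2 powr (- \<tau> * \<bar>real l - x\<bar>)" for l
  \<comment> \<open>Up to level \<open>x\<close> the first entry of the minimum is used and the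
    summands grow at rate \<open>1 / 2\<close>; beyond it the second entry is used and they decay at
    rate \<open>s\<close>. Both rates are at least \<tau>.\<close>
  proof (cases "real l \<le> x")
    case True
    have "2 powr (real l / 2) * min (N powr (- 1 / 2)) (2 powr (- real l * (s + 1 / 2)))
        \<le> 2 powr (real l / 2) * 2 powr (- x * (s + 1 / 2))"
      unfolding N1 by (rule mult_left_mono) auto
    also have "\<dots> = 2 powr (- x * s + - (1 / 2) * (x - real l))"
      unfolding powr_add[symmetric] by (rule arg_cong[where f = "(powr) 2"]) (simp add: field_simps)
    also have "\<dots> \<le> 2 powr (- x * s + - \<tau> * \<bar>real l - x\<bar>)"
      using True assms mult_right_mono[of \<tau> "1 / 2" "x - real l"] by (intro powr_mono) auto
    finally show ?thesis unfolding powr_add .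
  next
    case False
    have "2 powr (real l / 2) * min (N powr (- 1 / 2)) (2 powr (- real l * (s + 1 / 2)))
        \<le> 2 powr (real l / 2) * 2 powr (- real l * (s + 1 / 2))"
      by (rule mult_left_mono) auto
    also have "\<dots> = 2 powr (- x * s + - s * (real l - x))"
      unfolding powr_add[symmetric] by (rule arg_cong[where f = "(powr) 2"]) (simp add: field_simps)
    also have "\<dots> \<le> 2 powr (- x * s + - \<tau> * \<bar>real l - x\<bar>)"
      using False assms mult_right_mono[of \<tau> s "real l - x"] by (intro powr_mono) auto
    finally show ?thesis unfolding powr_add .
  qed
  then have "(\<Sum>l<L. 2 powr (real l / 2) * min (N powr (- 1 / 2)) (2 powr (- real l * (s + 1 / 2))))
      \<le> (\<Sum>l<L. 2 powr (- x * s) * 2 powr (- \<tau> * \<bar>real l - x\<bar>))"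
    by (rule sum_mono)
  also have "\<dots> \<le> 2 powr (- x * s) * (2 / (1 - 2 powr (- \<tau>)))"
    unfolding sum_distrib_left[symmetric]
    by (rule mult_left_mono[OF sum_powr_abs_diff_le[OF assms(2) x]]) simp
  finally show ?thesis unfolding N2 by (simp add: mult.commute)
qed

text \<open>The integrals over the two halves are compared with the same constant
  \<open>f x\<close>, which cancels in their difference; hence regularity at the single point
  \<open>x\<close> suffices. The exponent collects the normalisation \<open>l / 2\<close>, the
  oscillation \<open>- l * s\<close> and the interval length \<open>- l\<close>.\<close>

lemma haar_coeff_holder:
  fixes f :: "real \<Rightarrow> real"
  assumes f: "set_integrable lborel {0..1} f" and k: "k < 2 ^ l" "x \<in> dyadic l k"
    and s: "0 \<le> s" and H: "0 \<le> H" "\<And>y. y \<in> {0..1} \<Longrightarrow> \<bar>f y - f x\<bar> \<le> H * \<bar>y - x\<bar> powr s"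
  shows "\<bar>haar_coeff f (int l, k)\<bar> \<le> H * 2 powr (- real l * (s + 1 / 2))"
proof -
  define e where "e = H * (1 / 2 ^ l) powr s"
  have osc: "\<bar>f y - f x\<bar> \<le> e" if "y \<in> dyadic l k" for y
  proof -
    have "\<bar>f y - f x\<bar> \<le> H * \<bar>y - x\<bar> powr s"
      using H(2) dyadic_subset_unit[OF k(1)] that by blast
    also have "\<dots> \<le> e"
      unfolding e_def using H s dyadic_diameter[OF that k(2)] by (intro mult_left_mono powr_mono2) auto
    finally show ?thesis .
  qed
  have k': "2 * k < 2 ^ Suc l" "2 * k + 1 < 2 ^ Suc l" using k(1) by auto
  have "\<bar>(LINT y:dyadic (Suc l) (2 * k)|lborel. f y) - f x / 2 ^ Suc l\<bar> \<le> e / 2 ^ Suc l"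
    by (rule dyadic_average_error[OF f k'(1)]) (use osc dyadic_split(1) in blast)
  moreover have "\<bar>(LINT y:dyadic (Suc l) (2 * k + 1)|lborel. f y) - f x / 2 ^ Suc l\<bar> \<le> e / 2 ^ Suc l"
    by (rule dyadic_average_error[OF f k'(2)]) (use osc dyadic_split(1) in blast)
  moreover have "e / 2 ^ l = e / 2 ^ Suc l + e / 2 ^ Suc l" by (simp add: field_simps)
  ultimately have "\<bar>(LINT y:dyadic (Suc l) (2 * k)|lborel. f y) - (LINT y:dyadic (Suc l) (2 * k + 1)|lborel. f y)\<bar> \<le> e / 2 ^ l"
    by linarith
  then have "\<bar>haar_coeff f (int l, k)\<bar> \<le> 2 powr (real l / 2) * (e / 2 ^ l)"
    unfolding haar_coeff_eq[OF f k(1)] abs_mult by (intro mult_mono) auto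
  also have "\<dots> = H * (2 powr (real l / 2) * (1 / 2 ^ l) powr s * (1 / 2 ^ l))"
    unfolding e_def by simp
  also have "1 / 2 ^ l = 2 powr (- real l)" by (simp add: powr_minus powr_realpow field_simps)
  also have "(2 powr (- real l)) powr s = 2 powr (- real l * s)" by (rule powr_powr)
  also have "2 powr (real l / 2) * 2 powr (- real l * s) * 2 powr (- real l) = 2 powr (- real l * (s + 1 / 2))"
    unfolding powr_add[symmetric] by (rule arg_cong[where f = "(powr) 2"]) (simp add: field_simps)
  finally show ?thesis .
qed

lemma ln_ge_1: "3 \<le> n \<Longrightarrow> 1 \<le> ln (real n)"
  using exp_le by (subst ln_ge_iff) linarith+

lemma sqrt_ln_div: "3 \<le> n \<Longrightarrow> sqrt (ln (real n) / real n) = (real n / ln (real n)) powr (- 1 / 2)"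
proof -
  assume n: "3 \<le> n"
  have "(real n / ln (real n)) powr (- (1 / 2)) = inverse (sqrt (real n / ln (real n)))"
    using ln_ge_1[OF n] by (simp add: powr_minus powr_half_sqrt)
  then show ?thesis by (simp add: real_sqrt_divide)
qed

text \<open>This is the deterministic half of the argument. In the bound, the first \<open>A\<close>
  comes from the constant function, the product from the levels up to \<open>L_max n\<close>, and
  the last \<open>H\<close> from the truncation bias. The point \<open>x\<close> and its exponent
  \<open>s\<close> do not enter the bound, which makes it uniform over the unit interval.\<close>

lemma haar_error_bound:
  fixes f :: "real \<Rightarrow> real"
  defines "r \<equiv> \<lambda>n. sqrt (ln (real n) / real n)"
  assumes n: "3 \<le> n" and x: "x \<in> {0..1}" and s: "0 < t1" "t1 \<le> s" "s \<le> 1"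
    and f: "set_integrable lborel {0..1} f"
    and H: "0 \<le> H" "\<And>y. y \<in> {0..1} \<Longrightarrow> \<bar>f y - f x\<bar> \<le> H * \<bar>y - x\<bar> powr s"
    and a: "0 < a" "a \<le> A"
    and small: "\<And>i. i \<in> idx_upto n \<Longrightarrow> \<bar>haar_coeff f i\<bar> \<le> a * r n \<Longrightarrow> \<beta> i = 0"
    and large: "\<And>i. i \<in> idx_upto n \<Longrightarrow> a * r n < \<bar>haar_coeff f i\<bar> \<Longrightarrow> \<bar>\<beta> i - haar_coeff f i\<bar> \<le> A * r n"
  shows "rate n s * \<bar>haar_sum n \<beta> x - f x\<bar> \<le>
    A + (A + A * H / a + H) * (2 / (1 - 2 powr (- min t1 (1 / 2)))) + H"
proof -
  define L where "L = nat (L_max n)"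
  define N where "N = real n / ln (real n)"
  define K where "K = A + A * H / a + H"
  define c where "c = haar_coeff f"
  define \<rho> where "\<rho> = r n"
  have n1: "n \<ge> 1" using n by simp
  have ln1: "1 \<le> ln (real n)" by (rule ln_ge_1[OF n])
  have N1: "1 \<le> N" using ln1 ln_le_minus_one[of "real n"] n by (simp add: N_def)
  have Nn: "N \<le> real n" using ln1 n by (simp add: N_def divide_le_eq_1 field_simps)
  have r: "\<rho> = N powr (- 1 / 2)" unfolding \<rho>_def r_def N_def by (rule sqrt_ln_div[OF n])
  have r0: "0 \<le> \<rho>" unfolding r by simp
  have AHa: "0 \<le> A * H / a" using a H by simp
  have K: "A \<le> K" "H \<le> K" "A * H / a \<le> K" "0 \<le> K" unfolding K_def using a H AHa by linarith+
  have "\<forall>l. \<exists>k. k < 2 ^ l \<and> x \<in> dyadic l k" using ex_dyadic[OF x] by metis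
  then obtain \<kappa> where \<kappa>: "\<And>l. \<kappa> l < 2 ^ l" "\<And>l. x \<in> dyadic l (\<kappa> l)" by metis
  have hs: "haar_sum n b x = b (- 1, 0) * haar (- 1, 0) x + (\<Sum>l<Suc L. b (int l, \<kappa> l) * haar (int l, \<kappa> l) x)" for b
    unfolding haar_sum_def sum_idx_upto[OF n1 L_def] by (simp only: sum_haar_level[OF \<kappa>(2,1)])
  have hc: "haar_sum n c x = 2 ^ Suc L * (LINT y:dyadic (Suc L) (\<kappa> (Suc L))|lborel. f y)"
    unfolding haar_sum_def sum_idx_upto[OF n1 L_def] c_def by (rule haar_partial_sum[OF f \<kappa>])
  have idx: "(- 1, 0) \<in> idx_upto n" "l < Suc L \<Longrightarrow> (int l, \<kappa> l) \<in> idx_upto n" for l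
    using \<kappa>(1)[of l] unfolding idx_upto_eq(1)[OF n1 L_def] by (auto intro!: image_eqI)
  have d1: "\<bar>\<beta> i - c i\<bar> \<le> A * \<rho>" if "i \<in> idx_upto n" for i
  proof (cases "\<bar>c i\<bar> \<le> a * \<rho>")
    case True
    then have "\<bar>\<beta> i - c i\<bar> \<le> a * \<rho>" using small[OF that] by (simp add: c_def \<rho>_def)
    also have "\<dots> \<le> A * \<rho>" using a r0 by (intro mult_right_mono)
    finally show ?thesis .
  qed (use large[OF that] in \<open>simp add: c_def \<rho>_def\<close>)
  have d2: "\<bar>\<beta> (int l, \<kappa> l) - c (int l, \<kappa> l)\<bar> \<le> K * min \<rho> (2 powr (- real l * (s + 1 / 2)))"
    (is "?d \<le> K * min \<rho> ?v") if l: "l < Suc L" for l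
  proof -
    have v: "\<bar>c (int l, \<kappa> l)\<bar> \<le> H * ?v"
      unfolding c_def by (rule haar_coeff_holder[OF f \<kappa>]) (use s H in auto)
    have "?d \<le> A * \<rho>" by (rule d1[OF idx(2)[OF l]])
    also have "\<dots> \<le> K * \<rho>" using K r0 by (intro mult_right_mono)
    finally have "?d \<le> K * \<rho>" .
    \<comment> \<open>A coefficient set to zero has an error equal to its true size, at most
      \<open>H * ?v\<close>. A true coefficient above the threshold forces \<open>a * \<rho>\<close>
      below \<open>H * ?v\<close>, so its error \<open>A * \<rho>\<close> is at most
      \<open>(A * H / a) * ?v\<close>. The constant \<open>K\<close> dominates all factors that
      occur.\<close>
    moreover have "?d \<le> K * ?v"
    proof (cases "\<bar>c (int l, \<kappa> l)\<bar> \<le> a * \<rho>")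
      case True
      then have "?d \<le> H * ?v" using small[OF idx(2)[OF l]] v by (simp add: c_def \<rho>_def)
      also have "\<dots> \<le> K * ?v" using K by (intro mult_right_mono) auto
      finally show ?thesis .
    next
      case False
      then have "a * \<rho> \<le> H * ?v" using v by linarith
      then have "\<rho> \<le> H * ?v / a" using a by (simp add: field_simps)
      then have "A * \<rho> \<le> A * (H * ?v / a)" using a by (intro mult_left_mono) auto
      also have "\<dots> = (A * H / a) * ?v" by simp
      also have "\<dots> \<le> K * ?v" using K by (intro mult_right_mono) auto
      finally show ?thesis using d1[OF idx(2)[OF l]] by linarith
    qed
    ultimately show ?thesis using K(4) by (simp add: min_def)
  qed
  have D: "\<bar>haar_sum n \<beta> x - haar_sum n c x\<bar> \<le>
      A * \<rho> + K * (\<Sum>l<Suc L. 2 powr (real l / 2) * min \<rho> (2 powr (- real l * (s + 1 / 2))))"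
  proof -
    have "haar_sum n \<beta> x - haar_sum n c x = (\<beta> (- 1, 0) - c (- 1, 0)) * haar (- 1, 0) x +
        (\<Sum>l<Suc L. (\<beta> (int l, \<kappa> l) - c (int l, \<kappa> l)) * haar (int l, \<kappa> l) x)"
      unfolding hs left_diff_distrib sum_subtractf by simp
    also have "\<bar>\<dots>\<bar> \<le> \<bar>(\<beta> (- 1, 0) - c (- 1, 0)) * haar (- 1, 0) x\<bar> +
        (\<Sum>l<Suc L. \<bar>(\<beta> (int l, \<kappa> l) - c (int l, \<kappa> l)) * haar (int l, \<kappa> l) x\<bar>)"
      by (rule order_trans[OF abs_triangle_ineq add_left_mono[OF sum_abs]])
    also have "\<dots> \<le> A * \<rho> + (\<Sum>l<Suc L. K * min \<rho> (2 powr (- real l * (s + 1 / 2))) * 2 powr (real l / 2))"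
    proof (intro add_mono sum_mono)
      show "\<bar>(\<beta> (- 1, 0) - c (- 1, 0)) * haar (- 1, 0) x\<bar> \<le> A * \<rho>"
        using d1[OF idx(1)] x by (simp add: haar_def)
      fix l assume "l \<in> {..<Suc L}"
      then show "\<bar>(\<beta> (int l, \<kappa> l) - c (int l, \<kappa> l)) * haar (int l, \<kappa> l) x\<bar> \<le>
          K * min \<rho> (2 powr (- real l * (s + 1 / 2))) * 2 powr (real l / 2)"
        unfolding abs_mult abs_haar[OF \<kappa>(2)] by (intro mult_right_mono d2) auto
    qed
    finally show ?thesis by (simp add: sum_distrib_left mult_ac del: sum.lessThan_Suc)
  qed
  define \<zeta> where "\<zeta> = rate n s"
  have \<zeta>: "\<zeta> = N powr (s / (2 * s + 1))" by (simp add: \<zeta>_def rate_def N_def)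
  have s2: "0 < 2 * s + 1" using s by linarith
  have \<zeta>0: "0 \<le> \<zeta>" unfolding \<zeta> by simp
  have z1: "\<zeta> * \<rho> \<le> 1"
  proof -
    have "\<zeta> * \<rho> = N powr (s / (2 * s + 1) + - 1 / 2)" unfolding \<zeta> r powr_add ..
    also have "\<dots> \<le> N powr 0" using N1 s2 by (intro powr_mono) (auto simp: field_simps)
    finally show ?thesis using N1 by simp
  qed
  have z2: "\<zeta> * N powr (- s / (2 * s + 1)) = 1"
    unfolding \<zeta> powr_add[symmetric] using N1 by simp
  \<comment> \<open>This choice of \<tau> bounds both geometric rates from below by a number that
    does not depend on \<open>s\<close>.\<close>
  have \<tau>: "0 < min t1 (1 / 2)" "min t1 (1 / 2) \<le> s" "min t1 (1 / 2) \<le> 1 / 2" using s by auto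
  have S: "\<zeta> * (\<Sum>l<Suc L. 2 powr (real l / 2) * min \<rho> (2 powr (- real l * (s + 1 / 2)))) \<le>
      2 / (1 - 2 powr (- min t1 (1 / 2)))"
  proof -
    have "\<zeta> * (\<Sum>l<Suc L. 2 powr (real l / 2) * min \<rho> (2 powr (- real l * (s + 1 / 2)))) \<le>
        \<zeta> * (2 / (1 - 2 powr (- min t1 (1 / 2))) * N powr (- s / (2 * s + 1)))"
      unfolding r by (rule mult_left_mono[OF sum_min_rate_le[OF N1 \<tau>] \<zeta>0])
    also have "\<dots> = 2 / (1 - 2 powr (- min t1 (1 / 2))) * (\<zeta> * N powr (- s / (2 * s + 1)))"
      by simp
    finally show ?thesis unfolding z2 by simp
  qed
  \<comment> \<open>The partial sum with the true coefficients is a mean of \<open>f\<close> over an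
    interval shorter than \<open>1 / n\<close>, so the bias is at most
    \<open>H * n powr (- s)\<close>, whereas \<zeta> is at most \<open>n powr s\<close>.\<close>
  have T: "\<zeta> * \<bar>haar_sum n c x - f x\<bar> \<le> H"
  proof -
    have e: "\<bar>f y - f x\<bar> \<le> H * (1 / 2 ^ Suc L) powr s" if "y \<in> dyadic (Suc L) (\<kappa> (Suc L))" for y
    proof -
      have "\<bar>f y - f x\<bar> \<le> H * \<bar>y - x\<bar> powr s"
        using H(2) dyadic_subset_unit[OF \<kappa>(1)] that by blast
      also have "\<dots> \<le> H * (1 / 2 ^ Suc L) powr s"
        using H s dyadic_diameter[OF that \<kappa>(2)] by (intro mult_left_mono powr_mono2) auto
      finally show ?thesis .
    qed
    let ?I = "LINT y:dyadic (Suc L) (\<kappa> (Suc L))|lborel. f y"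
    have "\<bar>haar_sum n c x - f x\<bar> = 2 ^ Suc L * \<bar>?I - f x / 2 ^ Suc L\<bar>"
      unfolding hc by (subst abs_of_pos[of "2 ^ Suc L :: real", symmetric], simp)
        (simp only: abs_mult[symmetric], simp add: algebra_simps)
    also have "\<dots> \<le> 2 ^ Suc L * (H * (1 / 2 ^ Suc L) powr s / 2 ^ Suc L)"
      by (intro mult_left_mono dyadic_average_error[OF f \<kappa>(1) e]) auto
    also have "\<dots> = H * (1 / 2 ^ Suc L) powr s" by simp
    also have "\<dots> \<le> H * (1 / real n) powr s"
      using idx_upto_eq(3)[OF n1 L_def] n s H by (intro mult_left_mono powr_mono2) (auto intro!: divide_left_mono)
    finally have *: "\<bar>haar_sum n c x - f x\<bar> \<le> H * (1 / real n) powr s" .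
    have "\<zeta> \<le> N powr s"
      unfolding \<zeta> using N1 s s2 by (intro powr_mono) (auto simp: field_simps)
    also have "\<dots> \<le> real n powr s" using N1 Nn s by (intro powr_mono2) auto
    finally have "\<zeta> * \<bar>haar_sum n c x - f x\<bar> \<le> real n powr s * (H * (1 / real n) powr s)"
      using * \<zeta>0 H by (intro mult_mono) auto
    also have "\<dots> = H * (real n powr s * (1 / real n) powr s)" by simp
    also have "real n powr s * (1 / real n) powr s = 1"
      using n by (subst powr_mult[symmetric]) auto
    finally show ?thesis by simp
  qed
  define V where "V = (\<Sum>l<Suc L. 2 powr (real l / 2) * min \<rho> (2 powr (- real l * (s + 1 / 2))))"
  have "\<bar>haar_sum n \<beta> x - f x\<bar> \<le> A * \<rho> + K * V + \<bar>haar_sum n c x - f x\<bar>"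
    using D unfolding V_def[symmetric] by linarith
  then have "\<zeta> * \<bar>haar_sum n \<beta> x - f x\<bar> \<le> \<zeta> * (A * \<rho> + K * V + \<bar>haar_sum n c x - f x\<bar>)"
    using \<zeta>0 by (rule mult_left_mono)
  also have "\<dots> = A * (\<zeta> * \<rho>) + K * (\<zeta> * V) + \<zeta> * \<bar>haar_sum n c x - f x\<bar>"
    by (simp add: algebra_simps)
  also have "\<dots> \<le> A * 1 + K * (2 / (1 - 2 powr (- min t1 (1 / 2)))) + H"
    using a K by (intro add_mono mult_left_mono z1 S[folded V_def] T) auto
  finally show ?thesis unfolding \<zeta>_def K_def by simp
qed

section \<open>Global consequences of the local Hoelder condition\<close>

lemma local_holder_uniform:
  assumes f: "f \<in> local_holder t M \<eta>" and x: "x \<in> {0..1}" and y: "y \<in> {0..1}"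
    and M: "\<And>x. x \<in> {0..1} \<Longrightarrow> M x \<le> b"
    and \<eta>: "\<And>x. x \<in> {0..1} \<Longrightarrow> e \<le> \<eta> x" "0 < e" "e \<le> 1"
    and t: "0 \<le> t x" "t x \<le> 1"
  shows "\<bar>f y - f x\<bar> \<le> 2 * b / e * \<bar>y - x\<bar> powr t x"
proof -
  have f': "\<And>y. y \<in> {0..1} \<Longrightarrow> \<bar>f y\<bar> \<le> M x"
      "\<And>m. 0 < \<bar>m\<bar> \<and> \<bar>m\<bar> \<le> \<eta> x \<and> x + m \<in> {0..1} \<Longrightarrow> \<bar>f (x + m) - f x\<bar> / \<bar>m\<bar> powr t x \<le> M x"
    using f x unfolding local_holder_def by auto
  have Mb: "M x \<le> b" by (rule M[OF x])
  have b0: "0 \<le> b" using f'(1)[OF x] Mb by linarith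
  have be: "b \<le> 2 * b / e"
  proof -
    have "b * e \<le> b * 2" using b0 \<eta> by (intro mult_left_mono) auto
    then show ?thesis using \<eta> by (simp add: field_simps)
  qed
  \<comment> \<open>Within distance \<open>e\<close> the local condition applies. Farther away the
    sup-norm bound \<open>2 * b\<close> is enough, because \<open>e \<le> 1\<close> and
    \<open>t x \<le> 1\<close> give \<open>e \<le> \<bar>y - x\<bar> powr t x\<close>.\<close>
  consider "y = x" | "0 < \<bar>y - x\<bar>" "\<bar>y - x\<bar> \<le> e" | "e < \<bar>y - x\<bar>" by force
  then show ?thesis
  proof cases
    case 2
    have "\<bar>f (x + (y - x)) - f x\<bar> / \<bar>y - x\<bar> powr t x \<le> M x"
      by (rule f'(2)) (use 2 y \<eta>(1)[OF x] in auto)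
    then have "\<bar>f y - f x\<bar> \<le> M x * \<bar>y - x\<bar> powr t x" using 2 by (simp add: divide_le_eq)
    also have "\<dots> \<le> 2 * b / e * \<bar>y - x\<bar> powr t x" using Mb be by (intro mult_right_mono) auto
    finally show ?thesis .
  next
    case 3
    have "e = e powr 1" using \<eta> by simp
    also have "\<dots> \<le> e powr t x" using \<eta> t by (intro powr_mono') auto
    also have "\<dots> \<le> \<bar>y - x\<bar> powr t x" using 3 \<eta> t by (intro powr_mono2) auto
    finally have "2 * b / e * e \<le> 2 * b / e * \<bar>y - x\<bar> powr t x"
      using b0 \<eta> by (intro mult_left_mono) auto
    then have "2 * b \<le> 2 * b / e * \<bar>y - x\<bar> powr t x" using \<eta> by simp
    then show ?thesis using f'(1)[OF x] f'(1)[OF y] Mb by linarith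
  qed simp
qed

text \<open>The class carries no explicit measurability condition; a Hoelder bound with positive
  exponent at every point gives continuity, hence integrability on the compact interval.\<close>

lemma set_integrable_holder:
  fixes f :: "real \<Rightarrow> real"
  assumes "\<And>x y. x \<in> {0..1} \<Longrightarrow> y \<in> {0..1} \<Longrightarrow> \<bar>f y - f x\<bar> \<le> H * \<bar>y - x\<bar> powr t x"
    and t: "\<And>x. x \<in> {0..1} \<Longrightarrow> 0 < t x"
  shows "set_integrable lborel {0..1} f"
proof (rule borel_integrable_atLeastAtMost')
  show "continuous_on {0..1} f"
    unfolding continuous_on_def
  proof
    fix x :: real assume x: "x \<in> {0..1}"
    have "((\<lambda>y. \<bar>y - x\<bar> powr t x) \<longlongrightarrow> 0) (at x within {0..1})"
      using t[OF x] by (auto intro!: tendsto_eq_intros)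
    then have "((\<lambda>y. H * \<bar>y - x\<bar> powr t x) \<longlongrightarrow> 0) (at x within {0..1})"
      by (rule tendsto_mult_right_zero)
    then have "((\<lambda>y. f y - f x) \<longlongrightarrow> 0) (at x within {0..1})"
      by (rule Lim_null_comparison[rotated]) (use assms(1)[OF x] in \<open>auto simp: eventually_at_filter\<close>)
    then show "(f \<longlongrightarrow> f x) (at x within {0..1})" by (simp add: LIM_zero_iff)
  qed
qed

section \<open>Posterior of a single coordinate\<close>

definition slab_spike :: "(int \<times> nat \<Rightarrow> real \<Rightarrow> real) \<Rightarrow> (int \<times> nat) set \<Rightarrow> int \<times> nat \<Rightarrow> real measure" where
  "slab_spike \<pi> T i = (if i \<in> T then density lborel (\<pi> i) else return borel 0)"

lemma nn_integral_slab_spike: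
  assumes "i \<in> T \<Longrightarrow> \<pi> i \<in> borel_measurable borel" "F \<in> borel_measurable borel"
  shows "(\<integral>\<^sup>+b. F b \<partial>slab_spike \<pi> T i) =
    (if i \<in> T then \<integral>\<^sup>+b. ennreal (\<pi> i b) * F b \<partial>lborel else F 0)"
  using assms by (auto simp: slab_spike_def nn_integral_density nn_integral_return)

text \<open>Given the inclusion pattern the coordinates are independent, and only finitely many
  patterns occur, so a product integrand gives a finite sum of products. The likelihood, also when
  restricted by an event on one coordinate, has this product form.\<close>

lemma nn_integral_spike_slab:
  fixes F :: "int \<times> nat \<Rightarrow> real \<Rightarrow> ennreal"
  assumes fin: "finite (idx_upto n)" and supp: "set_pmf p \<subseteq> Pow (idx_upto n)"
    and \<pi>: "\<And>i. i \<in> idx_upto n \<Longrightarrow> \<pi> i \<in> borel_measurable borel"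
           "\<And>i. i \<in> idx_upto n \<Longrightarrow> prob_space (density lborel (\<pi> i))"
    and F[measurable]: "\<And>i. F i \<in> borel_measurable borel"
  shows "sets (spike_slab n p \<pi>) = sets (\<Pi>\<^sub>M i\<in>idx_upto n. borel)"
    and "(\<integral>\<^sup>+\<beta>. (\<Prod>i\<in>idx_upto n. F i (\<beta> i)) \<partial>spike_slab n p \<pi>) =
      (\<Sum>T\<in>Pow (idx_upto n). ennreal (pmf p T) * (\<Prod>i\<in>idx_upto n.
         if i \<in> T then \<integral>\<^sup>+b. ennreal (\<pi> i b) * F i b \<partial>lborel else F i 0))"
proof -
  define I where "I = idx_upto n"
  \<comment> \<open>The product locale requires a probability measure at every index, so indices
    outside \<open>I\<close> receive a point mass.\<close>
  define \<mu> where "\<mu> T i = (if i \<in> I then slab_spike \<pi> T i else return borel 0)" for T i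
  have ps: "prob_space (\<mu> T i)" for T i
    using \<pi>(2) by (auto simp: \<mu>_def slab_spike_def I_def intro: prob_space_return)
  have sm: "sets (\<mu> T i) = sets borel" for T i by (auto simp: \<mu>_def slab_spike_def)
  have eq: "(\<Pi>\<^sub>M i\<in>I. if i \<in> T then density lborel (\<pi> i) else return borel 0) = (\<Pi>\<^sub>M i\<in>I. \<mu> T i)" for T
    by (rule PiM_cong) (auto simp: \<mu>_def slab_spike_def)
  have sl: "spike_slab n p \<pi> = measure_pmf p \<bind> (\<lambda>T. \<Pi>\<^sub>M i\<in>I. \<mu> T i)"
    unfolding spike_slab_def I_def[symmetric] eq ..
  have sets: "sets (\<Pi>\<^sub>M i\<in>I. \<mu> T i) = sets (\<Pi>\<^sub>M i\<in>I. borel)" for T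
    by (rule sets_PiM_cong) (auto simp: sm)
  show ss: "sets (spike_slab n p \<pi>) = sets (\<Pi>\<^sub>M i\<in>idx_upto n. borel)"
    unfolding sl I_def[symmetric] by (rule sets_bind) (auto simp: sets)
  have pp: "prob_space (\<Pi>\<^sub>M i\<in>I. \<mu> T i)" for T by (rule prob_space_PiM) (rule ps)
  have meas: "(\<lambda>T. \<Pi>\<^sub>M i\<in>I. \<mu> T i) \<in> measurable (measure_pmf p) (subprob_algebra (\<Pi>\<^sub>M i\<in>I. borel))"
    unfolding measurable_pmf_measure1
    using pp by (auto simp: space_subprob_algebra sets prob_space_imp_subprob_space)
  have Fm: "(\<lambda>\<beta>. \<Prod>i\<in>I. F i (\<beta> i)) \<in> borel_measurable (\<Pi>\<^sub>M i\<in>I. borel)"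
    by measurable
  have "(\<integral>\<^sup>+\<beta>. (\<Prod>i\<in>I. F i (\<beta> i)) \<partial>spike_slab n p \<pi>) =
      (\<integral>\<^sup>+T. (\<integral>\<^sup>+\<beta>. (\<Prod>i\<in>I. F i (\<beta> i)) \<partial>(\<Pi>\<^sub>M i\<in>I. \<mu> T i)) \<partial>measure_pmf p)"
    unfolding sl by (rule nn_integral_bind[OF Fm meas])
  also have "\<dots> = (\<integral>\<^sup>+T. (\<Prod>i\<in>I. if i \<in> T then \<integral>\<^sup>+b. ennreal (\<pi> i b) * F i b \<partial>lborel else F i 0) \<partial>measure_pmf p)"
  proof (rule nn_integral_cong)
    fix T
    interpret product_prob_space "\<mu> T"
      by (simp add: product_prob_space_def product_prob_space_axioms_def product_sigma_finite_def ps
          prob_space_imp_sigma_finite)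
    have "(\<integral>\<^sup>+\<beta>. (\<Prod>i\<in>I. F i (\<beta> i)) \<partial>(\<Pi>\<^sub>M i\<in>I. \<mu> T i)) = (\<Prod>i\<in>I. integral\<^sup>N (\<mu> T i) (F i))"
      using fin by (intro product_nn_integral_prod) (auto simp: I_def measurable_cong_sets[OF sm refl])
    also have "\<dots> = (\<Prod>i\<in>I. if i \<in> T then \<integral>\<^sup>+b. ennreal (\<pi> i b) * F i b \<partial>lborel else F i 0)"
      by (rule prod.cong) (auto simp: \<mu>_def nn_integral_slab_spike \<pi>(1) I_def)
    finally show "(\<integral>\<^sup>+\<beta>. (\<Prod>i\<in>I. F i (\<beta> i)) \<partial>(\<Pi>\<^sub>M i\<in>I. \<mu> T i)) = \<dots>" .
  qed
  also have "\<dots> = (\<Sum>T\<in>Pow I. (\<Prod>i\<in>I. if i \<in> T then \<integral>\<^sup>+b. ennreal (\<pi> i b) * F i b \<partial>lborel else F i 0) * ennreal (pmf p T))"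
    using fin supp by (intro nn_integral_measure_pmf_support) (auto simp: I_def)
  finally show "(\<integral>\<^sup>+\<beta>. (\<Prod>i\<in>idx_upto n. F i (\<beta> i)) \<partial>spike_slab n p \<pi>) =
      (\<Sum>T\<in>Pow (idx_upto n). ennreal (pmf p T) * (\<Prod>i\<in>idx_upto n.
         if i \<in> T then \<integral>\<^sup>+b. ennreal (\<pi> i b) * F i b \<partial>lborel else F i 0))"
    unfolding I_def[symmetric] by (simp add: mult.commute)
qed

lemma sum_Pow_remove:
  assumes "finite I" "i \<in> I"
  shows "(\<Sum>T\<in>Pow I. g T) = (\<Sum>T\<in>Pow (I - {i}). g T + g (insert i T) :: 'a :: comm_monoid_add)"
proof -
  have "I = insert i (I - {i})" using assms by auto
  then have "Pow I = Pow (I - {i}) \<union> insert i ` Pow (I - {i})" by (metis Pow_insert)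
  then have "(\<Sum>T\<in>Pow I. g T) = (\<Sum>T\<in>Pow (I - {i}). g T) + (\<Sum>T\<in>insert i ` Pow (I - {i}). g T)"
    using assms by (simp only:) (rule sum.union_disjoint, auto)
  also have "(\<Sum>T\<in>insert i ` Pow (I - {i}). g T) = (\<Sum>T\<in>Pow (I - {i}). g (insert i T))"
    by (subst sum.reindex) (auto simp: inj_on_def)
  finally show ?thesis by (simp add: sum.distrib)
qed

text \<open>The inclusion patterns are paired as \<open>T\<close> and \<open>insert i T\<close>; the factors of all other
  coordinates are then common to numerator and denominator of the posterior.\<close>

lemma posterior_coordinate_le:
  fixes B :: "real set" and Y :: "int \<times> nat \<Rightarrow> real"
  assumes n: "n \<ge> 1"
    and A: "spike_slab_assumption n p \<omega> \<pi> c_T C_T B\<omega> \<delta> R c_R C_R"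
    and i: "(l, k) \<in> idx_upto n" and B[measurable]: "B \<in> sets borel" and h: "0 \<le> h"
  defines "\<phi> \<equiv> \<lambda>b. normal_density b (1 / sqrt (real n)) (Y (l, k))"
  assumes pair: "\<And>q0 q1. 0 \<le> q0 \<Longrightarrow> c_T * \<omega> l * q0 \<le> q1 \<Longrightarrow> q1 \<le> C_T * \<omega> l * q0 \<Longrightarrow>
      ennreal q0 * (indicator B 0 * ennreal (\<phi> 0)) +
      ennreal q1 * (\<integral>\<^sup>+b. ennreal (\<pi> (l, k) b) * (indicator B b * ennreal (\<phi> b)) \<partial>lborel)
      \<le> ennreal h * (ennreal q0 * ennreal (\<phi> 0) +
          ennreal q1 * (\<integral>\<^sup>+b. ennreal (\<pi> (l, k) b) * ennreal (\<phi> b) \<partial>lborel))"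
  shows "emeasure (posterior n (spike_slab n p \<pi>) Y)
    {\<beta> \<in> space (\<Pi>\<^sub>M i\<in>idx_upto n. borel). \<beta> (l, k) \<in> B} \<le> ennreal h"
proof -
  define I where "I = idx_upto n"
  define j where "j = (l, k)"
  define P where "P = spike_slab n p \<pi>"
  have fin: "finite (idx_upto n)" by (rule finite_idx_upto[OF n])
  have iI: "j \<in> I" using i by (simp add: I_def j_def)
  note A' = A[unfolded spike_slab_assumption_def]
  have supp: "set_pmf p \<subseteq> Pow (idx_upto n)" using A' by blast
  have \<pi>: "\<And>i. i \<in> idx_upto n \<Longrightarrow> \<pi> i \<in> borel_measurable borel"
       "\<And>i. i \<in> idx_upto n \<Longrightarrow> prob_space (density lborel (\<pi> i))"
    using A' by blast+
  \<comment> \<open>The product of these factors is the likelihood for \<open>E = UNIV\<close>; for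
    \<open>E = B\<close> it also carries the indicator of \<open>\<beta> j \<in> B\<close>. Its
    prior integral \<open>N E\<close> below is therefore an unnormalised posterior mass.\<close>
  define F where "F E i b = (if i = j then indicator E b else 1) *
      ennreal (normal_density b (1 / sqrt (real n)) (Y i))" for E i b
  have nm[measurable]: "(\<lambda>b. normal_density b (1 / sqrt (real n)) y) \<in> borel_measurable borel" for y
    unfolding normal_density_def by measurable
  have Fm[measurable]: "F E i \<in> borel_measurable borel" if [measurable]: "E \<in> sets borel" for E i
    unfolding F_def by measurable
  have setsP: "sets P = sets (\<Pi>\<^sub>M i\<in>I. borel)"
    unfolding P_def I_def by (rule nn_integral_spike_slab(1)[OF fin supp \<pi>, where F = "\<lambda>_ _. 0"]) auto
  have mP: "borel_measurable P = borel_measurable (\<Pi>\<^sub>M i\<in>I. borel)"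
    by (rule measurable_cong_sets[OF setsP refl])
  define G where "G i T E = (if i \<in> T then \<integral>\<^sup>+b. ennreal (\<pi> i b) * F E i b \<partial>lborel else F E i 0)" for i T E
  \<comment> \<open>This is the weight contributed by all other coordinates. It depends neither on
    the event at \<open>j\<close> nor on whether \<open>j\<close> belongs to
    \<open>T\<close>.\<close>
  define w where "w T = (\<Prod>i\<in>I - {j}. G i T UNIV)" for T
  have finI: "finite I" using fin by (simp add: I_def)
  have prodG: "(\<Prod>i\<in>I. G i T E) = G j T E * w T" if "E \<in> sets borel" for T E
  proof -
    have "(\<Prod>i\<in>I. G i T E) = G j T E * (\<Prod>i\<in>I - {j}. G i T E)"
      by (rule prod.remove[OF finI iI])
    also have "(\<Prod>i\<in>I - {j}. G i T E) = w T"
      unfolding w_def by (rule prod.cong) (auto simp: G_def F_def)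
    finally show ?thesis .
  qed
  have w_ins: "w (insert j T) = w T" for T
    unfolding w_def by (rule prod.cong) (auto simp: G_def)
  define N where "N E = (\<integral>\<^sup>+\<beta>. (\<Prod>i\<in>I. F E i (\<beta> i)) \<partial>P)" for E
  have N: "N E = (\<Sum>T\<in>Pow (I - {j}). w T * (ennreal (pmf p T) * F E j 0 +
      ennreal (pmf p (insert j T)) * (\<integral>\<^sup>+b. ennreal (\<pi> j b) * F E j b \<partial>lborel)))"
    if E: "E \<in> sets borel" for E
  proof -
    have "N E = (\<Sum>T\<in>Pow I. ennreal (pmf p T) * (\<Prod>i\<in>I. G i T E))"
      unfolding N_def G_def P_def I_def by (rule nn_integral_spike_slab(2)[OF fin supp \<pi>, where F = "F E"]) (auto simp: Fm[OF E])
    also have "\<dots> = (\<Sum>T\<in>Pow I. ennreal (pmf p T) * (G j T E * w T))"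
      using prodG[OF E] by simp
    also have "\<dots> = (\<Sum>T\<in>Pow (I - {j}). ennreal (pmf p T) * (G j T E * w T) +
        ennreal (pmf p (insert j T)) * (G j (insert j T) E * w (insert j T)))"
      by (rule sum_Pow_remove[OF finI iI])
    also have "\<dots> = (\<Sum>T\<in>Pow (I - {j}). w T * (ennreal (pmf p T) * F E j 0 +
      ennreal (pmf p (insert j T)) * (\<integral>\<^sup>+b. ennreal (\<pi> j b) * F E j b \<partial>lborel)))"
      by (rule sum.cong) (auto simp: w_ins G_def algebra_simps)
    finally show ?thesis .
  qed
  have UB: "UNIV \<in> sets (borel :: real measure)" by simp
  have FB: "F B j b = indicator B b * ennreal (\<phi> b)" for b
    by (simp add: F_def \<phi>_def j_def)
  have FU: "F UNIV j b = ennreal (\<phi> b)" for b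
    by (simp add: F_def \<phi>_def j_def)
  have Nle: "N B \<le> ennreal h * N UNIV"
    unfolding N[OF B] N[OF UB] sum_distrib_left
  proof (rule sum_mono)
    fix T assume T: "T \<in> Pow (I - {j})"
    have "T \<subseteq> idx_upto n \<and> (l, k) \<in> idx_upto n - T" using T iI by (auto simp: I_def j_def)
    then have "0 < pmf p T" "c_T * \<omega> l \<le> pmf p (T \<union> {j}) / pmf p T" "pmf p (T \<union> {j}) / pmf p T \<le> C_T * \<omega> l"
      using A' unfolding j_def by blast+
    then have "0 \<le> pmf p T" "c_T * \<omega> l * pmf p T \<le> pmf p (insert j T)" "pmf p (insert j T) \<le> C_T * \<omega> l * pmf p T"
      by (simp_all add: field_simps)
    from pair[OF this, folded j_def]
    have "ennreal (pmf p T) * F B j 0 + ennreal (pmf p (insert j T)) * (\<integral>\<^sup>+b. ennreal (\<pi> j b) * F B j b \<partial>lborel)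
      \<le> ennreal h * (ennreal (pmf p T) * F UNIV j 0 + ennreal (pmf p (insert j T)) * (\<integral>\<^sup>+b. ennreal (\<pi> j b) * F UNIV j b \<partial>lborel))"
      unfolding FB FU .
    then show "w T * (ennreal (pmf p T) * F B j 0 + ennreal (pmf p (insert j T)) * (\<integral>\<^sup>+b. ennreal (\<pi> j b) * F B j b \<partial>lborel))
      \<le> ennreal h * (w T * (ennreal (pmf p T) * F UNIV j 0 + ennreal (pmf p (insert j T)) * (\<integral>\<^sup>+b. ennreal (\<pi> j b) * F UNIV j b \<partial>lborel)))"
      unfolding mult.left_commute[of "ennreal h"] by (rule mult_left_mono) simp
  qed
  have lik: "ennreal (likelihood n Y \<beta>) = (\<Prod>i\<in>I. F UNIV i (\<beta> i))" for \<beta>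
    unfolding likelihood_def I_def[symmetric] F_def by (subst prod_ennreal[symmetric]) (auto intro!: prod.cong)
  have likB: "ennreal (likelihood n Y \<beta>) * indicator B (\<beta> j) = (\<Prod>i\<in>I. F B i (\<beta> i))" for \<beta>
  proof -
    have "(\<Prod>i\<in>I. F B i (\<beta> i)) = (\<Prod>i\<in>I. (if i = j then indicator B (\<beta> j) else 1) * F UNIV i (\<beta> i))"
      by (rule prod.cong) (auto simp: F_def)
    also have "\<dots> = (\<Prod>i\<in>I. (if i = j then indicator B (\<beta> j) else 1)) * (\<Prod>i\<in>I. F UNIV i (\<beta> i))"
      by (rule prod.distrib)
    finally show ?thesis using lik finI iI by (simp add: prod.delta mult.commute)
  qed
  have lik0: "0 \<le> likelihood n Y \<beta>" for \<beta>
    unfolding likelihood_def by (intro prod_nonneg) auto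
  have lm[measurable]: "likelihood n Y \<in> borel_measurable P"
    unfolding mP unfolding likelihood_def[abs_def] I_def[symmetric] by measurable
  define Z where "Z = (\<integral>b. likelihood n Y b \<partial>P)"
  have Z: "Z = enn2real (N UNIV)"
    unfolding Z_def N_def lik[symmetric] by (rule integral_eq_nn_integral) (auto simp: lik0)
  let ?E = "{\<beta> \<in> space (\<Pi>\<^sub>M i\<in>idx_upto n. borel). \<beta> (l, k) \<in> B}"
  have spP: "space (\<Pi>\<^sub>M i\<in>I. borel) = space P" using setsP by (metis sets_eq_imp_space_eq)
  have E: "?E \<in> sets P" unfolding setsP I_def using i by measurable
  have "emeasure (posterior n P Y) ?E = (\<integral>\<^sup>+\<beta>. ennreal (likelihood n Y \<beta> / Z) * indicator ?E \<beta> \<partial>P)"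
    unfolding posterior_def Z_def[symmetric] by (rule emeasure_density[OF _ E]) measurable
  also have "\<dots> = (\<integral>\<^sup>+\<beta>. ennreal (1 / Z) * (\<Prod>i\<in>I. F B i (\<beta> i)) \<partial>P)"
  proof (rule nn_integral_cong)
    fix \<beta> assume "\<beta> \<in> space P"
    then have "indicator ?E \<beta> = (indicator B (\<beta> j) :: ennreal)"
      using spP by (auto simp: indicator_def j_def I_def)
    moreover have "ennreal (likelihood n Y \<beta> / Z) = ennreal (1 / Z) * ennreal (likelihood n Y \<beta>)"
      using lik0 by (subst ennreal_mult[symmetric]) (auto simp: Z)
    ultimately show "ennreal (likelihood n Y \<beta> / Z) * indicator ?E \<beta> = ennreal (1 / Z) * (\<Prod>i\<in>I. F B i (\<beta> i))"
      using likB[of \<beta>] by (simp add: mult.assoc)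
  qed
  also have "\<dots> = ennreal (1 / Z) * N B"
    unfolding N_def by (rule nn_integral_cmult) (use Fm[OF B] in \<open>unfold mP, measurable\<close>)
  also have "\<dots> \<le> ennreal h"
  \<comment> \<open>An infinite \<open>N UNIV\<close> would also give \<open>Z = 0\<close>, since
    \<open>enn2real\<close> sends infinity to 0. In that case \<open>1 / Z = 0\<close> and the bound
    is trivial; otherwise \<open>Z\<close> is the true normalising constant.\<close>
  proof (cases "Z = 0")
    case False
    then have "N UNIV < top" using Z by (auto simp: less_top[symmetric])
    then have NZ: "N UNIV = ennreal Z" using Z by simp
    have "0 < Z" using False Z enn2real_nonneg[of "N UNIV"] by linarith
    then have "ennreal (1 / Z) * N UNIV = 1"
      unfolding NZ by (simp add: ennreal_mult[symmetric])
    have "ennreal (1 / Z) * N B \<le> ennreal (1 / Z) * (ennreal h * N UNIV)"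
      by (rule mult_left_mono[OF Nle]) simp
    also have "\<dots> = ennreal h"
      unfolding mult.left_commute[of "ennreal (1 / Z)"] \<open>ennreal (1 / Z) * N UNIV = 1\<close> by simp
    finally show ?thesis .
  qed simp
  finally show ?thesis unfolding P_def .
qed

section \<open>Gaussian integrals and the law of a single observation\<close>

lemma nn_integral_normal_density:
  "0 < \<sigma> \<Longrightarrow> (\<integral>\<^sup>+x. ennreal (normal_density m \<sigma> x) \<partial>lborel) = 1"
  by (subst nn_integral_eq_integral) auto

lemma normal_density_commute: "normal_density x \<sigma> y = normal_density y \<sigma> x"
  by (simp add: normal_density_def power2_commute)

text \<open>Half of the exponent is spent on the bound, the other half is a normal density of twice the
  variance.\<close>

lemma normal_tail_le:
  assumes \<sigma>: "0 < \<sigma>" and \<rho>: "0 \<le> \<rho>"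
  shows "(\<integral>\<^sup>+x. indicator {x. \<rho> < \<bar>x - m\<bar>} x * ennreal (normal_density m \<sigma> x) \<partial>lborel)
    \<le> ennreal (sqrt 2 * exp (- \<rho>\<^sup>2 / (4 * \<sigma>\<^sup>2)))"
proof -
  define c where "c = sqrt 2 * exp (- \<rho>\<^sup>2 / (4 * \<sigma>\<^sup>2))"
  have c: "0 \<le> c" by (simp add: c_def)
  have pw: "normal_density m \<sigma> x \<le> c * normal_density m (sqrt 2 * \<sigma>) x" if x: "\<rho> < \<bar>x - m\<bar>" for x
  proof -
    have "\<rho>\<^sup>2 \<le> (x - m)\<^sup>2" using x \<rho> by (metis abs_le_square_iff abs_of_nonneg less_imp_le)
    then have "\<rho>\<^sup>2 / (4 * \<sigma>\<^sup>2) \<le> (x - m)\<^sup>2 / (4 * \<sigma>\<^sup>2)" by (intro divide_right_mono) auto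
    moreover have "(x - m)\<^sup>2 / (2 * \<sigma>\<^sup>2) = (x - m)\<^sup>2 / (4 * \<sigma>\<^sup>2) + (x - m)\<^sup>2 / (4 * \<sigma>\<^sup>2)"
      using \<sigma> by (simp add: field_simps)
    ultimately have e: "exp (- (x - m)\<^sup>2 / (2 * \<sigma>\<^sup>2)) \<le>
        exp (- \<rho>\<^sup>2 / (4 * \<sigma>\<^sup>2)) * exp (- (x - m)\<^sup>2 / (4 * \<sigma>\<^sup>2))"
      by (simp add: exp_add[symmetric])
    have s: "sqrt 2 / sqrt (4 * pi * \<sigma>\<^sup>2) = 1 / sqrt (2 * pi * \<sigma>\<^sup>2)"
    proof -
      have "sqrt (4 * pi * \<sigma>\<^sup>2) = sqrt 2 * sqrt (2 * pi * \<sigma>\<^sup>2)"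
        unfolding real_sqrt_mult[symmetric] by simp
      then show ?thesis by simp
    qed
    have "normal_density m \<sigma> x \<le> 1 / sqrt (2 * pi * \<sigma>\<^sup>2) *
        (exp (- \<rho>\<^sup>2 / (4 * \<sigma>\<^sup>2)) * exp (- (x - m)\<^sup>2 / (4 * \<sigma>\<^sup>2)))"
      unfolding normal_density_def by (rule mult_left_mono[OF e]) simp
    also have "\<dots> = c * normal_density m (sqrt 2 * \<sigma>) x"
      unfolding normal_density_def c_def s[symmetric] by (simp add: power_mult_distrib mult_ac)
    finally show ?thesis .
  qed
  have "(\<integral>\<^sup>+x. indicator {x. \<rho> < \<bar>x - m\<bar>} x * ennreal (normal_density m \<sigma> x) \<partial>lborel)
      \<le> (\<integral>\<^sup>+x. ennreal c * ennreal (normal_density m (sqrt 2 * \<sigma>) x) \<partial>lborel)"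
    by (rule nn_integral_mono) (use pw c in \<open>auto simp: indicator_def ennreal_mult[symmetric]\<close>)
  also have "\<dots> = ennreal c"
    using \<sigma> by (subst nn_integral_cmult) (auto simp: nn_integral_normal_density)
  finally show ?thesis unfolding c_def .
qed

text \<open>Each coordinate of the infinite product noise is standard normal, so the expectation of
  a function of one observation is a one-dimensional integral.\<close>

lemma nn_integral_data_law:
  assumes i: "i \<in> haar_idx" and g[measurable]: "g \<in> borel_measurable borel"
  shows "(\<integral>\<^sup>+Y. g (Y i) \<partial>data_law n c) =
    (\<integral>\<^sup>+e. ennreal (std_normal_density e) * g (c i + e / sqrt (real n)) \<partial>lborel)"
proof -
  let ?N = "density lborel std_normal_density"
  have sN: "sets noise = sets (\<Pi>\<^sub>M i\<in>haar_idx. borel)"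
    unfolding noise_def by (rule sets_PiM_cong) auto
  have mN: "measurable noise M = measurable (\<Pi>\<^sub>M i\<in>haar_idx. borel) M" for M :: "'z measure"
    by (rule measurable_cong_sets[OF sN refl])
  have m: "(\<lambda>\<epsilon>. \<lambda>i\<in>haar_idx. c i + \<epsilon> i / sqrt (real n)) \<in> noise \<rightarrow>\<^sub>M (\<Pi>\<^sub>M i\<in>haar_idx. borel)"
    unfolding mN by measurable
  have gm: "(\<lambda>Y. g (Y i)) \<in> borel_measurable (\<Pi>\<^sub>M i\<in>haar_idx. borel)"
    using i by measurable
  have D: "distr noise ?N (\<lambda>\<omega>. \<omega> i) = ?N"
    unfolding noise_def by (rule distr_PiM_component) (auto intro: prob_space_normal_density i)
  have "(\<integral>\<^sup>+Y. g (Y i) \<partial>data_law n c) = (\<integral>\<^sup>+\<epsilon>. g (c i + \<epsilon> i / sqrt (real n)) \<partial>noise)"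
    unfolding data_law_def by (subst nn_integral_distr[OF m]) (use gm i in simp_all)
  also have "\<dots> = (\<integral>\<^sup>+e. g (c i + e / sqrt (real n)) \<partial>distr noise ?N (\<lambda>\<omega>. \<omega> i))"
    by (rule nn_integral_distr[symmetric]) (use i in \<open>auto simp: mN\<close>)
  also have "\<dots> = (\<integral>\<^sup>+e. g (c i + e / sqrt (real n)) \<partial>?N)" unfolding D ..
  also have "\<dots> = (\<integral>\<^sup>+e. ennreal (std_normal_density e) * g (c i + e / sqrt (real n)) \<partial>lborel)"
    by (rule nn_integral_density) auto
  finally show ?thesis .
qed

section \<open>Posterior probability of a failing coordinate for fixed data\<close>

lemma posterior_le_1:
  assumes n: "n \<ge> 1"
    and A: "spike_slab_assumption n p \<omega> \<pi> c_T C_T B\<omega> \<delta> R c_R C_R"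
    and i: "(l, k) \<in> idx_upto n" and B[measurable]: "B \<in> sets borel"
  shows "emeasure (posterior n (spike_slab n p \<pi>) Y)
    {\<beta> \<in> space (\<Pi>\<^sub>M i\<in>idx_upto n. borel). \<beta> (l, k) \<in> B} \<le> ennreal 1"
proof -
  \<comment> \<open>The pairing condition holds with \<open>h = 1\<close> because the indicator only
    decreases the numerator. This crude bound serves where the noise is large.\<close>
  have ind: "indicator B b * z \<le> z" for b and z :: ennreal by (auto simp: indicator_def)
  show ?thesis
    by (rule posterior_coordinate_le[OF n A i B])
      (simp_all only: zero_le_one ennreal_1 mult_1, intro add_mono mult_left_mono nn_integral_mono ind, auto)
qed

text \<open>The slab contributes at most \<open>C_R\<close>, as the normal density integrates to 1
  over \<open>b\<close>. The denominator is reduced to its spike term, and the last two factors of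
  the bound are the reciprocal of the likelihood of \<open>Y\<close> at zero;
  \<open>C_T * \<omega> l\<close> bounds the prior odds.\<close>

lemma posterior_inclusion_le:
  assumes n: "n \<ge> 1"
    and A: "spike_slab_assumption n p \<omega> \<pi> c_T C_T B\<omega> \<delta> R c_R C_R"
    and C: "0 < C_T" "0 < C_R"
    and i: "(l, k) \<in> idx_upto n"
  shows "emeasure (posterior n (spike_slab n p \<pi>) Y)
    {\<beta> \<in> space (\<Pi>\<^sub>M i\<in>idx_upto n. borel). \<beta> (l, k) \<in> - {0}}
    \<le> ennreal (C_T * C_R * \<omega> l * sqrt (2 * pi / real n) * exp (real n * (Y (l, k))\<^sup>2 / 2))"
proof (rule posterior_coordinate_le[OF n A i])
  let ?\<sigma> = "1 / sqrt (real n)"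
  let ?\<phi> = "\<lambda>b. normal_density b ?\<sigma> (Y (l, k))"
  let ?h = "C_T * C_R * \<omega> l * sqrt (2 * pi / real n) * exp (real n * (Y (l, k))\<^sup>2 / 2)"
  note A' = A[unfolded spike_slab_assumption_def]
  have l: "-1 \<le> l" "l \<le> L_max n" using i by (auto simp: idx_upto_def haar_idx_def)
  then have \<omega>: "0 < \<omega> l" using A' by blast
  show "0 \<le> ?h" using \<omega> C by simp
  have \<pi>: "\<And>b. 0 \<le> \<pi> (l, k) b" "\<And>b. \<pi> (l, k) b \<le> C_R" using A' i by blast+
  have \<sigma>: "0 < ?\<sigma>" using n by simp
  have h\<phi>: "?h * ?\<phi> 0 = C_T * C_R * \<omega> l"
  proof -
    have "sqrt (2 * pi / real n) * (1 / sqrt (2 * pi * ?\<sigma>\<^sup>2)) = 1"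
      using n by (simp add: power_divide)
    moreover have "exp (real n * (Y (l, k))\<^sup>2 / 2) * exp (- (Y (l, k) - 0)\<^sup>2 / (2 * ?\<sigma>\<^sup>2)) = 1"
      using n by (simp add: power_divide exp_add[symmetric] mult.commute)
    ultimately have "C_T * C_R * \<omega> l * (sqrt (2 * pi / real n) * (1 / sqrt (2 * pi * ?\<sigma>\<^sup>2))) *
        (exp (real n * (Y (l, k))\<^sup>2 / 2) * exp (- (Y (l, k) - 0)\<^sup>2 / (2 * ?\<sigma>\<^sup>2))) = C_T * C_R * \<omega> l"
      by simp
    then show ?thesis unfolding normal_density_def by (simp only: mult_ac)
  qed
  fix q0 q1 :: real
  assume q: "0 \<le> q0" "c_T * \<omega> l * q0 \<le> q1" "q1 \<le> C_T * \<omega> l * q0"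
  have "(\<integral>\<^sup>+b. ennreal (\<pi> (l, k) b) * (indicator (- {0}) b * ennreal (?\<phi> b)) \<partial>lborel) \<le>
      (\<integral>\<^sup>+b. ennreal C_R * ennreal (normal_density (Y (l, k)) ?\<sigma> b) \<partial>lborel)"
    unfolding normal_density_commute[of _ _ "Y (l, k)"]
    by (rule nn_integral_mono, rule mult_mono) (use \<pi> in \<open>auto simp: indicator_def ennreal_leI\<close>)
  also have "\<dots> = ennreal C_R"
    using \<sigma> by (subst nn_integral_cmult) (auto simp: nn_integral_normal_density)
  finally have I: "(\<integral>\<^sup>+b. ennreal (\<pi> (l, k) b) * (indicator (- {0}) b * ennreal (?\<phi> b)) \<partial>lborel) \<le> ennreal C_R" .
  have "ennreal q0 * (indicator (- {0}) 0 * ennreal (?\<phi> 0)) +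
      ennreal q1 * (\<integral>\<^sup>+b. ennreal (\<pi> (l, k) b) * (indicator (- {0}) b * ennreal (?\<phi> b)) \<partial>lborel)
      \<le> ennreal q1 * ennreal C_R"
    using mult_left_mono[OF I, of "ennreal q1"] by simp
  also have "\<dots> = ennreal (q1 * C_R)" using C by (simp add: ennreal_mult'')
  also have "\<dots> \<le> ennreal (q0 * (?h * ?\<phi> 0))"
    unfolding h\<phi> using mult_right_mono[OF q(3), of C_R] C by (intro ennreal_leI) (simp add: mult_ac)
  also have "\<dots> = ennreal ?h * (ennreal q0 * ennreal (?\<phi> 0))"
    using q(1) \<open>0 \<le> ?h\<close> by (simp add: ennreal_mult[symmetric] mult_ac)
  also have "\<dots> \<le> ennreal ?h * (ennreal q0 * ennreal (?\<phi> 0) +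
          ennreal q1 * (\<integral>\<^sup>+b. ennreal (\<pi> (l, k) b) * ennreal (?\<phi> b) \<partial>lborel))"
    by (intro mult_left_mono add_increasing2) auto
  finally show "ennreal q0 * (indicator (- {0}) 0 * ennreal (?\<phi> 0)) +
      ennreal q1 * (\<integral>\<^sup>+b. ennreal (\<pi> (l, k) b) * (indicator (- {0}) b * ennreal (?\<phi> b)) \<partial>lborel)
      \<le> ennreal ?h * (ennreal q0 * ennreal (?\<phi> 0) +
          ennreal q1 * (\<integral>\<^sup>+b. ennreal (\<pi> (l, k) b) * ennreal (?\<phi> b) \<partial>lborel))" .
qed auto

lemma exp_ln_powr: "0 < x \<Longrightarrow> exp (c * ln x) = x powr c" for x c :: real
  by (simp add: powr_def)

text \<open>The noise uses up \<open>3 * r\<close> of the radius, so every \<open>b\<close> in the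
  bad set is more than \<open>D * r\<close> away from the observation, where the likelihood is
  polynomially small. The denominator is reduced to the slab mass of an interval of length
  \<open>1 / sqrt n\<close> next to \<open>b0\<close>, which costs only a fixed power of
  \<open>n\<close>.\<close>

lemma posterior_deviation_le:
  assumes n: "n \<ge> 3"
    and A: "spike_slab_assumption n p \<omega> \<pi> c_T C_T B\<omega> \<delta> R c_R C_R"
    and C: "0 < c_T" "0 < c_R" "0 < C_R" "0 < B\<omega>"
    and i: "(l, k) \<in> idx_upto n"
    and b0: "\<bar>b0\<bar> \<le> R" "1 / sqrt (real n) \<le> R"
    and Y: "\<bar>Y (l, k) - b0\<bar> \<le> 3 * sqrt (ln (real n) / real n)"
  shows "emeasure (posterior n (spike_slab n p \<pi>) Y)
    {\<beta> \<in> space (\<Pi>\<^sub>M i\<in>idx_upto n. borel).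
      \<beta> (l, k) \<in> {b. (3 + 2 * sqrt (B\<omega> + 20)) * sqrt (ln (real n) / real n) < \<bar>b - b0\<bar>}}
    \<le> ennreal (sqrt (2 * pi) / c_R * (1 / c_T + C_R * sqrt 2) * real n powr (- 2))"
proof -
  define r where "r = sqrt (ln (real n) / real n)"
  \<comment> \<open>The tail exponent is \<open>D\<^sup>2 / 4 = B\<omega> + 20\<close>: enough to
    compensate for prior odds as small as \<open>n powr (- B\<omega>)\<close> and for the power 8
    lost in the denominator.\<close>
  define D where "D = 2 * sqrt (B\<omega> + 20)"
  define B where "B = {b. (3 + D) * r < \<bar>b - b0\<bar>}"
  define y where "y = Y (l, k)"
  define \<sigma> where "\<sigma> = 1 / sqrt (real n)"
  define \<phi> where "\<phi> b = normal_density b \<sigma> y" for b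
  define h where "h = sqrt (2 * pi) / c_R * (1 / c_T + C_R * sqrt 2) * real n powr (- 2)"
  define K where "K = 1 / c_T + C_R * sqrt 2"
  \<comment> \<open>Lower bound for the marginal likelihood under the slab: on the interval
    \<open>J\<close> the distance to the observation is at most \<open>4 * r\<close>, and the
    exponent is \<open>4\<^sup>2 / 2 = 8\<close>. The length \<open>1 / sqrt n\<close> of
    \<open>J\<close> cancels the factor \<open>sqrt n\<close> of the normal density.\<close>
  define v where "v = c_R / sqrt (2 * pi) * real n powr (- 8)"
  have n0: "0 < real n" "1 \<le> real n" "n \<ge> 1" using n by auto
  have ln1: "1 \<le> ln (real n)" by (rule ln_ge_1[OF n])
  have r: "0 \<le> r" "real n * r\<^sup>2 = ln (real n)" using ln1 n0 by (auto simp: r_def)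
  have \<sigma>: "0 < \<sigma>" "\<sigma>\<^sup>2 = 1 / real n" using n0 by (auto simp: \<sigma>_def power_divide)
  have D: "0 \<le> D" "D\<^sup>2 = 4 * (B\<omega> + 20)" using C by (auto simp: D_def power_mult_distrib)
  have y: "\<bar>y - b0\<bar> \<le> 3 * r" using Y by (simp add: y_def r_def)
  note A' = A[unfolded spike_slab_assumption_def]
  have l: "-1 \<le> l" "l \<le> L_max n" using i by (auto simp: idx_upto_def haar_idx_def)
  then have \<omega>: "0 < \<omega> l" "real n powr (- B\<omega>) \<le> \<omega> l" using A' by blast+
  have \<pi>: "\<And>b. 0 \<le> \<pi> (l, k) b" "\<And>b. \<pi> (l, k) b \<le> C_R" "\<And>b. \<bar>b\<bar> \<le> R \<Longrightarrow> c_R \<le> \<pi> (l, k) b"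
    using A' i by blast+
  have K0: "0 \<le> K" using C by (simp add: K_def)
  have h0: "0 \<le> h" unfolding h_def using C by simp
  have \<phi>_eq: "\<phi> b = sqrt (real n) / sqrt (2 * pi) * exp (- (real n * (y - b)\<^sup>2 / 2))" for b
    unfolding \<phi>_def normal_density_def \<sigma> using n0 by (simp add: real_sqrt_divide real_sqrt_mult mult.commute)
  have Br: "D * r < \<bar>b - y\<bar>" if "b \<in> B" for b
    using that y unfolding B_def by (simp add: distrib_right)
  \<comment> \<open>The spike itself may lie in the bad set. The factor
    \<open>n powr (- B\<omega>)\<close> is kept apart because the lower bound on the prior odds
    later trades it for \<open>q1 / c_T\<close> in place of \<open>q0\<close>.\<close>
  have u0: "indicator B 0 * ennreal (\<phi> 0) \<le> ennreal (real n powr (- B\<omega>) * real n powr (- 10))"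
  proof (cases "0 \<in> B")
    case True
    have "(D * r)\<^sup>2 \<le> y\<^sup>2"
      using power_mono[of "D * r" "\<bar>y\<bar>" 2] Br[OF True] D r by simp
    then have "real n * (D * r)\<^sup>2 / 2 \<le> real n * (y - 0)\<^sup>2 / 2"
      by (simp add: mult_left_mono)
    moreover have "real n * (D * r)\<^sup>2 / 2 = D\<^sup>2 / 2 * ln (real n)"
      unfolding power_mult_distrib r(2)[symmetric] by simp
    ultimately have "exp (- (real n * (y - 0)\<^sup>2 / 2)) \<le> exp (- (D\<^sup>2 / 2) * ln (real n))" by simp
    also have "\<dots> = real n powr (- (D\<^sup>2 / 2))" by (rule exp_ln_powr[OF n0(1)])
    finally have e: "exp (- (real n * (y - 0)\<^sup>2 / 2)) \<le> real n powr (- (D\<^sup>2 / 2))" .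
    have s: "sqrt (real n) / sqrt (2 * pi) \<le> real n powr 1"
    proof -
      have "1 \<le> sqrt (2 * pi)" using pi_gt3 by simp
      then have "sqrt (real n) / sqrt (2 * pi) \<le> sqrt (real n)" by (simp add: divide_le_eq mult_le_cancel_left1)
      also have "\<dots> \<le> real n" using n0 by (simp add: sqrt_le_D real_le_lsqrt power2_eq_square)
      finally show ?thesis using n0 by simp
    qed
    have "\<phi> 0 \<le> real n powr 1 * real n powr (- (D\<^sup>2 / 2))"
      unfolding \<phi>_eq using e s by (intro mult_mono) auto
    also have "\<dots> = real n powr (1 - D\<^sup>2 / 2)" by (subst powr_add[symmetric]) simp
    also have "\<dots> \<le> real n powr (- B\<omega> + - 10)"
    proof (rule powr_mono)
      have "D\<^sup>2 / 2 = 2 * B\<omega> + 40" by (simp add: D)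
      then show "1 - D\<^sup>2 / 2 \<le> - B\<omega> + - 10" using C by linarith
    qed (use n0 in simp)
    also have "\<dots> = real n powr (- B\<omega>) * real n powr (- 10)" by (rule powr_add)
    finally show ?thesis using True by (simp add: ennreal_leI)
  qed simp
  have u1: "(\<integral>\<^sup>+b. ennreal (\<pi> (l, k) b) * (indicator B b * ennreal (\<phi> b)) \<partial>lborel) \<le>
      ennreal (C_R * sqrt 2 * real n powr (- 10))"
  proof -
    have "(\<integral>\<^sup>+b. ennreal (\<pi> (l, k) b) * (indicator B b * ennreal (\<phi> b)) \<partial>lborel) \<le>
        (\<integral>\<^sup>+b. ennreal C_R * (indicator {b. D * r < \<bar>b - y\<bar>} b * ennreal (normal_density y \<sigma> b)) \<partial>lborel)"
      unfolding \<phi>_def normal_density_commute[of _ _ y]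
      by (rule nn_integral_mono, intro mult_mono) (use \<pi> Br in \<open>auto simp: indicator_def ennreal_leI\<close>)
    also have "\<dots> = ennreal C_R * (\<integral>\<^sup>+b. (indicator {b. D * r < \<bar>b - y\<bar>} b * ennreal (normal_density y \<sigma> b)) \<partial>lborel)"
      by (rule nn_integral_cmult) measurable
    also have "\<dots> \<le> ennreal C_R * ennreal (sqrt 2 * exp (- (D * r)\<^sup>2 / (4 * \<sigma>\<^sup>2)))"
      by (intro mult_left_mono normal_tail_le \<sigma>) (use D r in auto)
    also have "- (D * r)\<^sup>2 / (4 * \<sigma>\<^sup>2) = - (B\<omega> + 20) * ln (real n)"
      unfolding \<sigma> power_mult_distrib D r(2)[symmetric] using n0 by (simp add: field_simps)
    also have "exp \<dots> = real n powr (- (B\<omega> + 20))" by (rule exp_ln_powr[OF n0(1)])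
    also have "ennreal C_R * ennreal (sqrt 2 * real n powr (- (B\<omega> + 20))) = ennreal (C_R * sqrt 2 * real n powr (- (B\<omega> + 20)))"
      using C by (simp add: ennreal_mult[symmetric] mult.assoc)
    also have "\<dots> \<le> ennreal (C_R * sqrt 2 * real n powr (- 10))"
      using C n0 by (intro ennreal_leI mult_left_mono powr_mono) auto
    finally show ?thesis .
  qed
  have v0: "0 \<le> v" using C by (simp add: v_def)
  have v1: "ennreal v \<le> (\<integral>\<^sup>+b. ennreal (\<pi> (l, k) b) * ennreal (\<phi> b) \<partial>lborel)"
  proof -
    \<comment> \<open>Choosing the side of \<open>b0\<close> that faces the origin keeps \<open>J\<close> inside \<open>[-R, R]\<close>.\<close>
    define J where "J = (if 0 \<le> b0 then {b0 - \<sigma>..b0} else {b0..b0 + \<sigma>})"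
    have J: "\<bar>b\<bar> \<le> R" "\<bar>b - b0\<bar> \<le> \<sigma>" if "b \<in> J" for b
      using that b0 \<sigma> unfolding J_def \<sigma>_def[symmetric] by (auto split: if_splits)
    have eJ: "emeasure lborel J = ennreal \<sigma>" using \<sigma> by (auto simp: J_def)
    have mJ: "J \<in> sets lborel" by (auto simp: J_def)
    have low: "c_R * (sqrt (real n) / sqrt (2 * pi) * real n powr (- 8)) \<le> \<pi> (l, k) b * \<phi> b" if "b \<in> J" for b
    proof -
      have sn: "1 \<le> sqrt (ln (real n))" using ln1 by simp
      have sr: "r = sqrt (ln (real n)) * \<sigma>" by (simp add: r_def \<sigma>_def real_sqrt_divide)
      have "\<bar>y - b\<bar> \<le> 3 * r + \<sigma>" using y J(2)[OF that] by linarith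
      also have "\<dots> \<le> 4 * r" using mult_right_mono[OF sn, of \<sigma>] \<sigma> unfolding sr by simp
      finally have "(y - b)\<^sup>2 \<le> (4 * r)\<^sup>2" using power_mono[of "\<bar>y - b\<bar>" "4 * r" 2] by simp
      then have "real n * (y - b)\<^sup>2 / 2 \<le> real n * (4 * r)\<^sup>2 / 2"
        by (intro divide_right_mono mult_left_mono) auto
      also have "\<dots> = 8 * ln (real n)" unfolding r(2)[symmetric] by (simp add: power_mult_distrib)
      finally have "exp (- 8 * ln (real n)) \<le> exp (- (real n * (y - b)\<^sup>2 / 2))" by simp
      then have "real n powr (- 8) \<le> exp (- (real n * (y - b)\<^sup>2 / 2))"
        unfolding exp_ln_powr[OF n0(1)] .
      then show ?thesis unfolding \<phi>_eq using \<pi>(3)[OF J(1)[OF that]] C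
        by (intro mult_mono mult_left_mono) auto
    qed
    have "ennreal v = ennreal (c_R * (sqrt (real n) / sqrt (2 * pi) * real n powr (- 8))) * ennreal \<sigma>"
      unfolding v_def \<sigma>_def using C n0 by (simp add: ennreal_mult[symmetric] field_simps)
    also have "\<dots> = (\<integral>\<^sup>+b. ennreal (c_R * (sqrt (real n) / sqrt (2 * pi) * real n powr (- 8))) * indicator J b \<partial>lborel)"
      using mJ eJ by (simp add: nn_integral_cmult_indicator)
    also have "\<dots> \<le> (\<integral>\<^sup>+b. ennreal (\<pi> (l, k) b) * ennreal (\<phi> b) \<partial>lborel)"
      by (rule nn_integral_mono)
        (use low \<pi>(1) in \<open>auto simp: indicator_def ennreal_mult[symmetric] \<phi>_def intro!: ennreal_leI\<close>)
    finally show ?thesis .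
  qed
  \<comment> \<open>Of the power 10 gained in the numerator, 8 pays for \<open>v\<close> and 2
    remains, so a sum over \<open>2 * n\<close> coordinates still vanishes.\<close>
  have hv: "h * v = K * real n powr (- 10)"
  proof -
    have "h * v = (sqrt (2 * pi) / c_R * (c_R / sqrt (2 * pi))) * (K * (real n powr (- 2) * real n powr (- 8)))"
      unfolding h_def v_def K_def by simp
    then show ?thesis using C by (simp add: powr_add[symmetric])
  qed
  have "emeasure (posterior n (spike_slab n p \<pi>) Y)
    {\<beta> \<in> space (\<Pi>\<^sub>M i\<in>idx_upto n. borel). \<beta> (l, k) \<in> B} \<le> ennreal h"
  proof (rule posterior_coordinate_le[OF n0(3) A i _ h0, where Y = Y, folded \<sigma>_def y_def, folded \<phi>_def])
    show "B \<in> sets borel" unfolding B_def by measurable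
    fix q0 q1 :: real
    assume q: "0 \<le> q0" "c_T * \<omega> l * q0 \<le> q1"
    have q1: "0 \<le> q1" by (rule order_trans[OF _ q(2)]) (use q(1) C \<omega> in simp)
    have "real n powr (- B\<omega>) * q0 \<le> \<omega> l * q0" using \<omega> q by (intro mult_right_mono)
    also have "\<dots> \<le> q1 / c_T" using q(2) C by (simp add: field_simps)
    finally have qq: "real n powr (- B\<omega>) * q0 \<le> q1 / c_T" .
    have "ennreal q0 * (indicator B 0 * ennreal (\<phi> 0)) \<le> ennreal q0 * ennreal (real n powr (- B\<omega>) * real n powr (- 10))"
      by (rule mult_left_mono[OF u0]) simp
    also have "\<dots> = ennreal (real n powr (- B\<omega>) * q0 * real n powr (- 10))"
      using q by (simp add: ennreal_mult[symmetric] mult_ac)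
    also have "\<dots> \<le> ennreal (q1 / c_T * real n powr (- 10))"
      by (intro ennreal_leI mult_right_mono[OF qq]) simp
    finally have "ennreal q0 * (indicator B 0 * ennreal (\<phi> 0)) +
        ennreal q1 * (\<integral>\<^sup>+b. ennreal (\<pi> (l, k) b) * (indicator B b * ennreal (\<phi> b)) \<partial>lborel)
      \<le> ennreal (q1 / c_T * real n powr (- 10)) + ennreal q1 * ennreal (C_R * sqrt 2 * real n powr (- 10))"
      by (intro add_mono mult_left_mono u1) auto
    also have "\<dots> = ennreal (q1 * (K * real n powr (- 10)))"
      unfolding K_def using q1 C
      by (simp add: ennreal_mult[symmetric] ennreal_plus[symmetric] algebra_simps del: ennreal_plus)
    also have "\<dots> = ennreal h * (ennreal q1 * ennreal v)"
      unfolding hv[symmetric] using q1 h0 v0 by (simp add: ennreal_mult[symmetric] mult_ac)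
    also have "\<dots> \<le> ennreal h * (ennreal q0 * ennreal (\<phi> 0) +
        ennreal q1 * (\<integral>\<^sup>+b. ennreal (\<pi> (l, k) b) * ennreal (\<phi> b) \<partial>lborel))"
      by (intro mult_left_mono add_increasing v1) auto
    finally show "ennreal q0 * (indicator B 0 * ennreal (\<phi> 0)) +
        ennreal q1 * (\<integral>\<^sup>+b. ennreal (\<pi> (l, k) b) * (indicator B b * ennreal (\<phi> b)) \<partial>lborel)
      \<le> ennreal h * (ennreal q0 * ennreal (\<phi> 0) +
        ennreal q1 * (\<integral>\<^sup>+b. ennreal (\<pi> (l, k) b) * ennreal (\<phi> b) \<partial>lborel))" .
  qed
  then show ?thesis unfolding B_def D_def r_def h_def .
qed

section \<open>Expected posterior risk\<close>

text \<open>Large noise is met with the trivial bound 1. The threshold 3 gives a Gaussian tail of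
  order \<open>n powr (- 9 / 4)\<close>, which remains negligible after multiplication by the number
  of indices.\<close>

lemma truncated_expectation_le:
  fixes h :: "real \<Rightarrow> real"
  assumes n: "n \<ge> 3" and h[measurable]: "h \<in> borel_measurable borel" "\<And>y. 0 \<le> h y"
    and u: "0 \<le> u" "(\<integral>\<^sup>+e. indicator {e. \<bar>e\<bar> \<le> 3 * sqrt (ln (real n))} e *
      ennreal (std_normal_density e * h (c + e / sqrt (real n))) \<partial>lborel) \<le> ennreal u"
  shows "(\<integral>\<^sup>+e. ennreal (std_normal_density e) * ennreal
      (if 3 * sqrt (ln (real n) / real n) < \<bar>c + e / sqrt (real n) - c\<bar> then 1 else h (c + e / sqrt (real n))) \<partial>lborel)
    \<le> ennreal (sqrt 2 * real n powr (- 9 / 4) + u)"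
proof -
  define \<rho> where "\<rho> = 3 * sqrt (ln (real n))"
  have n0: "0 < real n" using n by simp
  have ln1: "1 \<le> ln (real n)" by (rule ln_ge_1[OF n])
  have iff: "3 * sqrt (ln (real n) / real n) < \<bar>c + e / sqrt (real n) - c\<bar> \<longleftrightarrow> \<rho> < \<bar>e\<bar>" for e
    using n0 by (simp add: \<rho>_def real_sqrt_divide abs_divide divide_less_cancel)
  have "(\<integral>\<^sup>+e. ennreal (std_normal_density e) * ennreal
      (if 3 * sqrt (ln (real n) / real n) < \<bar>c + e / sqrt (real n) - c\<bar> then 1 else h (c + e / sqrt (real n))) \<partial>lborel)
    = (\<integral>\<^sup>+e. indicator {e. \<rho> < \<bar>e - 0\<bar>} e * ennreal (std_normal_density e) +
        indicator {e. \<bar>e\<bar> \<le> \<rho>} e * ennreal (std_normal_density e * h (c + e / sqrt (real n))) \<partial>lborel)"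
    unfolding iff by (rule nn_integral_cong) (auto simp: indicator_def ennreal_mult h(2))
  also have "\<dots> = (\<integral>\<^sup>+e. indicator {e. \<rho> < \<bar>e - 0\<bar>} e * ennreal (std_normal_density e) \<partial>lborel) +
        (\<integral>\<^sup>+e. indicator {e. \<bar>e\<bar> \<le> \<rho>} e * ennreal (std_normal_density e * h (c + e / sqrt (real n))) \<partial>lborel)"
    by (rule nn_integral_add) measurable
  also have "\<dots> \<le> ennreal (sqrt 2 * exp (- \<rho>\<^sup>2 / (4 * 1\<^sup>2))) + ennreal u"
    using u(2) ln1 unfolding \<rho>_def[symmetric] by (intro add_mono normal_tail_le) (auto simp: \<rho>_def)
  also have "- \<rho>\<^sup>2 / (4 * 1\<^sup>2) = (- 9 / 4) * ln (real n)"
    using ln1 by (simp add: \<rho>_def power_mult_distrib)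
  also have "exp \<dots> = real n powr (- 9 / 4)" by (rule exp_ln_powr[OF n0])
  finally show ?thesis using u by (simp add: ennreal_plus)
qed

text \<open>With \<open>m = sqrt n * c\<close>, the noise density cancels the quadratic growth of
  the Bayes factor and leaves \<open>exp (m * e + m\<^sup>2 / 2)\<close>. On the truncated range
  this is at most \<open>n\<close> to the power \<open>3 * a + a / 2\<close>. The factor
  \<open>6 * sqrt (ln n)\<close> is the length of that range.\<close>

lemma expectation_inclusion_le:
  assumes n: "n \<ge> 3" and w: "0 \<le> w" and a: "0 < a" "a \<le> 1"
    and c: "\<bar>c\<bar> \<le> a * sqrt (ln (real n) / real n)"
  shows "(\<integral>\<^sup>+e. indicator {e. \<bar>e\<bar> \<le> 3 * sqrt (ln (real n))} e *
      ennreal (std_normal_density e * (w * sqrt (2 * pi / real n) *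
        exp (real n * (c + e / sqrt (real n))\<^sup>2 / 2))) \<partial>lborel)
    \<le> ennreal (6 * w * real n powr (- 1 / 2 + 7 / 2 * a) * sqrt (ln (real n)))"
proof -
  define \<rho> where "\<rho> = 3 * sqrt (ln (real n))"
  define q where "q = sqrt (ln (real n))"
  have n0: "0 < real n" using n by simp
  have ln1: "1 \<le> ln (real n)" by (rule ln_ge_1[OF n])
  have q: "0 \<le> q" "q * q = ln (real n)" using ln1 by (auto simp: q_def)
  define m where "m = sqrt (real n) * c"
  have m: "\<bar>m\<bar> \<le> a * q"
  proof -
    have "\<bar>m\<bar> = sqrt (real n) * \<bar>c\<bar>" using n0 by (simp add: m_def abs_mult)
    also have "\<dots> \<le> sqrt (real n) * (a * sqrt (ln (real n) / real n))" by (rule mult_left_mono[OF c]) simp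
    also have "\<dots> = a * q" using n0 by (simp add: q_def real_sqrt_divide)
    finally show ?thesis .
  qed
  define U where "U = w * real n powr (- 1 / 2 + 7 / 2 * a)"
  have pw: "std_normal_density e * (w * sqrt (2 * pi / real n) * exp (real n * (c + e / sqrt (real n))\<^sup>2 / 2)) \<le> U"
    if e: "\<bar>e\<bar> \<le> \<rho>" for e
  proof -
    have sq: "real n * (c + e / sqrt (real n))\<^sup>2 = (m + e)\<^sup>2"
    proof -
      have "(m + e)\<^sup>2 = (sqrt (real n) * (c + e / sqrt (real n)))\<^sup>2" using n0 by (simp add: m_def distrib_left)
      then show ?thesis using n0 by (simp add: power_mult_distrib)
    qed
    have "m * e \<le> \<bar>m\<bar> * \<bar>e\<bar>" by (metis abs_ge_self abs_mult)
    also have "\<dots> \<le> (a * q) * (3 * q)"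
      by (rule mult_mono) (use m e a q in \<open>auto simp: \<rho>_def q_def\<close>)
    also have "\<dots> = 3 * a * ln (real n)" unfolding q(2)[symmetric] by simp
    finally have b1: "m * e \<le> 3 * a * ln (real n)" .
    have "\<bar>m\<bar> * \<bar>m\<bar> \<le> (a * q) * (a * q)"
      by (rule mult_mono) (use m a q in auto)
    then have "m\<^sup>2 \<le> (a * a) * ln (real n)" by (simp add: power2_eq_square q(2)[symmetric] mult_ac)
    also have "\<dots> \<le> (a * 1) * ln (real n)" using a ln1 by (intro mult_right_mono mult_left_mono) auto
    finally have b2: "m\<^sup>2 \<le> a * ln (real n)" by simp
    have ex: "exp (- e\<^sup>2 / 2) * exp ((m + e)\<^sup>2 / 2) = exp (m * e + m\<^sup>2 / 2)"
      by (simp add: exp_add[symmetric] power2_sum field_simps)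
    have "exp (m * e + m\<^sup>2 / 2) \<le> exp (7 / 2 * a * ln (real n))" using b1 b2 by simp
    also have "\<dots> = real n powr (7 / 2 * a)" by (rule exp_ln_powr[OF n0])
    finally have ex2: "exp (m * e + m\<^sup>2 / 2) \<le> real n powr (7 / 2 * a)" .
    have sn: "1 / sqrt (2 * pi) * sqrt (2 * pi / real n) = real n powr (- 1 / 2)"
      using n0 by (simp add: real_sqrt_divide powr_minus_divide powr_half_sqrt)
    have "std_normal_density e * (w * sqrt (2 * pi / real n) * exp (real n * (c + e / sqrt (real n))\<^sup>2 / 2))
        = w * (1 / sqrt (2 * pi) * sqrt (2 * pi / real n)) * (exp (- e\<^sup>2 / 2) * exp ((m + e)\<^sup>2 / 2))"
      unfolding sq std_normal_density_def by (simp only: mult_ac)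
    also have "\<dots> \<le> w * real n powr (- 1 / 2) * real n powr (7 / 2 * a)"
      unfolding sn ex using w ex2 by (intro mult_left_mono) auto
    also have "\<dots> = U" unfolding U_def powr_add by simp
    finally show ?thesis .
  qed
  have "(\<integral>\<^sup>+e. indicator {e. \<bar>e\<bar> \<le> \<rho>} e *
      ennreal (std_normal_density e * (w * sqrt (2 * pi / real n) *
        exp (real n * (c + e / sqrt (real n))\<^sup>2 / 2))) \<partial>lborel)
      \<le> (\<integral>\<^sup>+e. ennreal U * indicator {- \<rho>..\<rho>} e \<partial>lborel)"
    by (rule nn_integral_mono) (use pw in \<open>auto simp: indicator_def intro!: ennreal_leI\<close>)
  also have "\<dots> = ennreal U * ennreal (2 * \<rho>)"
    using q by (subst nn_integral_cmult_indicator) (auto simp: \<rho>_def q_def)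
  also have "\<dots> = ennreal (U * (2 * \<rho>))" using w q by (simp add: ennreal_mult U_def \<rho>_def q_def)
  also have "U * (2 * \<rho>) = 6 * w * real n powr (- 1 / 2 + 7 / 2 * a) * sqrt (ln (real n))"
    by (simp add: U_def \<rho>_def)
  finally show ?thesis unfolding \<rho>_def .
qed

text \<open>The majorant \<open>h\<close> is 1 for large noise and otherwise the inclusion or the
  deviation bound, according to the size of \<open>b0\<close>. It is Borel and depends on one
  observation only, so its expectation is a one-dimensional Gaussian integral.\<close>

lemma posterior_coordinate_risk:
  fixes a b0 :: real
  defines "r \<equiv> \<lambda>n. sqrt (ln (real n) / real n)"
  assumes n: "n \<ge> 3"
    and A: "spike_slab_assumption n p \<omega> \<pi> c_T C_T B\<omega> \<delta> R c_R C_R"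
    and C: "0 < c_T" "0 < C_T" "0 < c_R" "0 < C_R" "0 < B\<omega>" and a: "0 < a" "a \<le> 1"
    and i: "(l, k) \<in> idx_upto n"
    and b0: "\<bar>b0\<bar> \<le> R" "1 / sqrt (real n) \<le> R"
  defines "B \<equiv> if \<bar>b0\<bar> \<le> a * r n then - {0} else {b. (3 + 2 * sqrt (B\<omega> + 20)) * r n < \<bar>b - b0\<bar>}"
  obtains h :: "real \<Rightarrow> real" where "h \<in> borel_measurable borel" "\<And>y. 0 \<le> h y"
    "\<And>Y. emeasure (posterior n (spike_slab n p \<pi>) Y)
       {\<beta> \<in> space (\<Pi>\<^sub>M i\<in>idx_upto n. borel). \<beta> (l, k) \<in> B} \<le> ennreal (h (Y (l, k)))"
    "(\<integral>\<^sup>+e. ennreal (std_normal_density e) * ennreal (h (b0 + e / sqrt (real n))) \<partial>lborel) \<le>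
      ennreal (sqrt 2 * real n powr (- 9 / 4) + (
        sqrt (2 * pi) / c_R * (1 / c_T + C_R * sqrt 2) * real n powr (- 2) +
        6 * (C_T * C_R * \<omega> l) * real n powr (- 1 / 2 + 7 / 2 * a) * sqrt (ln (real n))))"
proof -
  define K where "K = sqrt (2 * pi) / c_R * (1 / c_T + C_R * sqrt 2) * real n powr (- 2)"
  define E where "E = 6 * (C_T * C_R * \<omega> l) * real n powr (- 1 / 2 + 7 / 2 * a) * sqrt (ln (real n))"
  have n1: "n \<ge> 1" using n by simp
  have Bm: "B \<in> sets borel" unfolding B_def by (cases "\<bar>b0\<bar> \<le> a * r n") auto
  have l: "-1 \<le> l" "l \<le> L_max n" using i by (auto simp: idx_upto_def haar_idx_def)
  then have \<omega>: "0 < \<omega> l" using A unfolding spike_slab_assumption_def by blast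
  have K0: "0 \<le> K" unfolding K_def using C by simp
  have E0: "0 \<le> E" unfolding E_def using C \<omega> ln_ge_1[OF n] by simp
  define g where "g y = (if \<bar>b0\<bar> \<le> a * r n then C_T * C_R * \<omega> l * sqrt (2 * pi / real n) * exp (real n * y\<^sup>2 / 2)
      else K)" for y
  have gm[measurable]: "g \<in> borel_measurable borel" unfolding g_def by measurable
  have g0: "0 \<le> g y" for y unfolding g_def using K0 C \<omega> by simp
  have gE: "(\<integral>\<^sup>+e. indicator {e. \<bar>e\<bar> \<le> 3 * sqrt (ln (real n))} e *
      ennreal (std_normal_density e * g (b0 + e / sqrt (real n))) \<partial>lborel) \<le> ennreal (K + E)"
  proof (cases "\<bar>b0\<bar> \<le> a * r n")
    case True
    have "(\<integral>\<^sup>+e. indicator {e. \<bar>e\<bar> \<le> 3 * sqrt (ln (real n))} e *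
      ennreal (std_normal_density e * g (b0 + e / sqrt (real n))) \<partial>lborel) \<le> ennreal E"
      using expectation_inclusion_le[OF n _ a, of "C_T * C_R * \<omega> l" b0] True C \<omega>
      unfolding g_def E_def r_def by simp
    also have "\<dots> \<le> ennreal (K + E)" using K0 by (intro ennreal_leI) simp
    finally show ?thesis .
  next
    case False
    have "(\<integral>\<^sup>+e. indicator {e. \<bar>e\<bar> \<le> 3 * sqrt (ln (real n))} e *
      ennreal (std_normal_density e * g (b0 + e / sqrt (real n))) \<partial>lborel) \<le>
      (\<integral>\<^sup>+e. ennreal K * ennreal (std_normal_density e) \<partial>lborel)"
      by (rule nn_integral_mono) (use False K0 in \<open>auto simp: g_def indicator_def ennreal_mult mult.commute\<close>)
    also have "\<dots> = ennreal K" by (subst nn_integral_cmult) (auto simp: nn_integral_normal_density)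
    also have "\<dots> \<le> ennreal (K + E)" using E0 by (intro ennreal_leI) simp
    finally show ?thesis .
  qed
  define h where "h y = (if 3 * sqrt (ln (real n) / real n) < \<bar>y - b0\<bar> then 1 else g y)" for y
  show ?thesis
  proof (rule that[of h])
    show "h \<in> borel_measurable borel" unfolding h_def by measurable
    show "0 \<le> h y" for y unfolding h_def using g0 by simp
    show "(\<integral>\<^sup>+e. ennreal (std_normal_density e) * ennreal (h (b0 + e / sqrt (real n))) \<partial>lborel) \<le>
      ennreal (sqrt 2 * real n powr (- 9 / 4) + (
        sqrt (2 * pi) / c_R * (1 / c_T + C_R * sqrt 2) * real n powr (- 2) +
        6 * (C_T * C_R * \<omega> l) * real n powr (- 1 / 2 + 7 / 2 * a) * sqrt (ln (real n))))"
      unfolding h_def K_def[symmetric] E_def[symmetric]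
      by (rule truncated_expectation_le[OF n gm g0 _ gE]) (use K0 E0 in simp)
    show "emeasure (posterior n (spike_slab n p \<pi>) Y)
       {\<beta> \<in> space (\<Pi>\<^sub>M i\<in>idx_upto n. borel). \<beta> (l, k) \<in> B} \<le> ennreal (h (Y (l, k)))" for Y
    proof (cases "3 * sqrt (ln (real n) / real n) < \<bar>Y (l, k) - b0\<bar>")
      case True
      then show ?thesis using posterior_le_1[OF n1 A i Bm, of Y] by (simp add: h_def)
    next
      case False
      note Y = this
      show ?thesis
      proof (cases "\<bar>b0\<bar> \<le> a * r n")
        case True
        then show ?thesis
          using posterior_inclusion_le[OF n1 A C(2,4) i, of Y] Y by (simp add: h_def g_def B_def)
      next
        case False
        show ?thesis
          using posterior_deviation_le[OF n A C(1,3,4,5) i b0, of Y] Y False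
          by (simp add: h_def g_def B_def r_def K_def)
      qed
    qed
  qed
qed

text \<open>Here \<open>g\<close> stands for the posterior probability as a function of the data,
  whose measurability is not assumed: if \<open>g\<close> is not integrable, its Bochner integral is
  0 and the bound still holds.\<close>

lemma integral_le_of_nn_integral_le:
  fixes g h :: "'a \<Rightarrow> real"
  assumes h: "h \<in> borel_measurable M" "\<And>x. 0 \<le> h x" and gh: "\<And>x. g x \<le> h x"
    and e: "0 \<le> e" "(\<integral>\<^sup>+x. ennreal (h x) \<partial>M) \<le> ennreal e"
  shows "(\<integral>x. g x \<partial>M) \<le> e"
proof -
  have int: "integrable M h"
    by (rule integrableI_bounded) (use h e le_less_trans[OF e(2) ennreal_less_top] in auto)
  have "(\<integral>x. g x \<partial>M) \<le> (\<integral>x. h x \<partial>M)"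
    by (rule integral_mono'[OF int]) (use gh h in auto)
  also have "\<dots> = enn2real (\<integral>\<^sup>+x. ennreal (h x) \<partial>M)"
    by (rule integral_eq_nn_integral) (use h in auto)
  also have "\<dots> \<le> e" by (rule enn2real_leI) (use e in auto)
  finally show ?thesis .
qed

section \<open>From single coordinates to uniform contraction\<close>

lemma card_idx_upto_le: assumes "n \<ge> 1" shows "real (card (idx_upto n)) \<le> 2 * real n"
proof -
  define L where "L = nat (L_max n)"
  have "real (card (idx_upto n)) = (\<Sum>i\<in>idx_upto n. 1)" by simp
  also have "\<dots> = 1 + (\<Sum>l<Suc L. 2 ^ l)"
    by (subst sum_idx_upto[OF assms L_def]) simp
  also have "(\<Sum>l<Suc L. (2 :: real) ^ l) = 2 ^ Suc L - 1"
    by (subst geometric_sum) auto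
  finally show ?thesis using idx_upto_eq(2)[OF assms L_def] by simp
qed

text \<open>The \<open>2 ^ l\<close> indices of level \<open>l\<close> together contribute at most
  \<open>W\<close>, and the index \<open>(-1, 0)\<close> at most \<open>2 * W\<close>; the number of
  levels is logarithmic in \<open>n\<close>.\<close>

lemma sum_weights_le:
  assumes n: "n \<ge> 1" and W: "0 \<le> W"
    and \<omega>: "\<And>l. -1 \<le> l \<Longrightarrow> l \<le> L_max n \<Longrightarrow> \<omega> l \<le> W * 2 powr (- real_of_int l)"
  shows "(\<Sum>i\<in>idx_upto n. \<omega> (fst i)) \<le> W * (ln (real n) / ln 2 + 3)"
proof -
  define L where "L = nat (L_max n)"
  have L: "L_max n = int L" by (rule idx_upto_eq(4)[OF n L_def])
  have "real L \<le> log 2 (real n)" using L unfolding L_max_def by linarith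
  then have Ln: "real L \<le> ln (real n) / ln 2" by (simp add: log_def)
  have lev: "2 ^ l * \<omega> (int l) \<le> W" if "l < Suc L" for l
  proof -
    have "2 ^ l * \<omega> (int l) \<le> 2 ^ l * (W * 2 powr (- real_of_int (int l)))"
      by (intro mult_left_mono \<omega>) (use that L in auto)
    also have "\<dots> = W" by (simp add: powr_minus powr_realpow)
    finally show ?thesis .
  qed
  have "(\<Sum>i\<in>idx_upto n. \<omega> (fst i)) = \<omega> (- 1) + (\<Sum>l<Suc L. 2 ^ l * \<omega> (int l))"
    by (subst sum_idx_upto[OF n L_def]) simp
  also have "\<dots> \<le> W * 2 + (\<Sum>l<Suc L. W)"
    using \<omega>[of "- 1"] L lev by (intro add_mono sum_mono) auto
  also have "\<dots> = W * (real L + 3)" by (simp add: algebra_simps)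
  also have "\<dots> \<le> W * (ln (real n) / ln 2 + 3)" using Ln W by (intro mult_left_mono) auto
  finally show ?thesis .
qed

theorem theorem3:
  fixes t M \<eta> :: "real \<Rightarrow> real"
    and p :: "nat \<Rightarrow> (int \<times> nat) set pmf"
    and \<omega> :: "nat \<Rightarrow> int \<Rightarrow> real"
    and \<pi> :: "nat \<Rightarrow> int \<times> nat \<Rightarrow> real \<Rightarrow> real"
    and t\<^sub>1 c_T C_T B_\<omega> \<delta> R c_R C_R :: real
  assumes M: "\<exists>a b. 0 < a \<and> (\<forall>x\<in>{0..1}. a \<le> M x \<and> M x \<le> b)"
    and \<eta>: "\<exists>a b. 0 < a \<and> (\<forall>x\<in>{0..1}. a \<le> \<eta> x \<and> \<eta> x \<le> b)"
    and t: "0 < t\<^sub>1" "\<forall>x\<in>{0..1}. t\<^sub>1 \<le> t x \<and> t x \<le> 1"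
    and constants: "0 < c_T" "0 < C_T" "0 < B_\<omega>" "0 < \<delta>" "0 < R" "0 < c_R" "0 < C_R"
    and prior: "\<forall>n\<ge>1. spike_slab_assumption n (p n) (\<omega> n) (\<pi> n) c_T C_T B_\<omega> \<delta> R c_R C_R"
    and R_large: "\<forall>f\<^sub>0\<in>local_holder t M \<eta>. \<forall>i\<in>haar_idx. \<bar>haar_coeff f\<^sub>0 i\<bar> \<le> R"
  shows "\<exists>M\<^sub>0>0. \<forall>M'\<ge>M\<^sub>0.
    (\<lambda>n. SUP f\<^sub>0\<in>local_holder t M \<eta>.
       \<integral>Y. measure (posterior n (spike_slab n (p n) (\<pi> n)) Y)
              {\<beta> \<in> space (\<Pi>\<^sub>M i\<in>idx_upto n. borel).
                 (SUP x\<in>{0..1}. rate n (t x) * \<bar>haar_sum n \<beta> x - f\<^sub>0 x\<bar>) > M'}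
         \<partial>data_law n (haar_coeff f\<^sub>0)) \<longlonglongrightarrow> 0"
proof -
  obtain a\<^sub>M b where Mb: "0 < a\<^sub>M" "\<And>x. x \<in> {0..1} \<Longrightarrow> a\<^sub>M \<le> M x \<and> M x \<le> b" using M by blast
  obtain e' where e': "0 < e'" "\<And>x. x \<in> {0..1} \<Longrightarrow> e' \<le> \<eta> x" using \<eta> by blast
  define e where "e = min 1 e'"
  have e: "0 < e" "e \<le> 1" "\<And>x. x \<in> {0..1} \<Longrightarrow> e \<le> \<eta> x"
    using e' by (auto simp: e_def intro: min.coboundedI2)
  have b: "0 < b" using Mb(1) Mb(2)[of 0] by auto
  define H where "H = 2 * b / e"
  have H: "0 \<le> H" using b e by (simp add: H_def)
  \<comment> \<open>Spurious inclusions have total weight of order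
    \<open>n powr ((1 - \<delta>) / 2)\<close> up to logarithms, against
    \<open>n powr (- 1 / 2)\<close> from the Bayes factors. Keeping \<open>7 / 2 * a\<close> below
    \<open>\<delta> / 8\<close> leaves the exponent \<open>- 3 * \<delta> / 8\<close>.\<close>
  define a where "a = min 1 (\<delta> / 28)"
  have a: "0 < a" "a \<le> 1" "7 / 2 * a \<le> \<delta> / 8" using constants by (auto simp: a_def)
  define A where "A = 3 + 2 * sqrt (B_\<omega> + 20)"
  have A: "3 \<le> A" "a \<le> A" using a constants by (auto simp: A_def intro: order_trans[of a 1])
  define r where "r n = sqrt (ln (real n) / real n)" for n :: nat
  define M\<^sub>0 where "M\<^sub>0 = A + (A + A * H / a + H) * (2 / (1 - 2 powr (- min t\<^sub>1 (1 / 2)))) + H"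
  have M0: "0 < M\<^sub>0"
  proof -
    have "2 powr (- min t\<^sub>1 (1 / 2)) < 1" using t by (auto simp: powr_less_one)
    moreover have "0 \<le> A * H / a" using A H a by simp
    ultimately show ?thesis unfolding M\<^sub>0_def using A H by (intro add_pos_nonneg mult_nonneg_nonneg) auto
  qed
  define K where "K = sqrt (2 * pi) / c_R * (1 / c_T + C_R * sqrt 2)"
  have K: "0 \<le> K" using constants by (simp add: K_def)
  \<comment> \<open>The first summand multiplies the noise tail and the deviation bound by the at
    most \<open>2 * n\<close> indices; the second sums the inclusion bounds using the total prior
    weight.\<close>
  define \<epsilon> where "\<epsilon> n = 2 * real n * (sqrt 2 * real n powr (- 9 / 4) + K * real n powr (- 2)) +
      6 * C_T * C_R * real n powr (- 1 / 2 + \<delta> / 8) * sqrt (ln (real n)) *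
        (real n powr ((1 - \<delta>) / 2) * (ln (real n) / ln 2 + 3))" for n :: nat
  have \<epsilon>_lim: "\<epsilon> \<longlonglongrightarrow> 0"
  proof -
    have 1: "(\<lambda>n. 2 * real n * (sqrt 2 * real n powr (- 9 / 4) + K * real n powr (- 2))) \<longlonglongrightarrow> 0"
      by real_asymp
    have 2: "(\<lambda>n. (6 * C_T * C_R) * (sqrt (ln (real n)) * (ln (real n) / ln 2 + 3) * real n powr (- (3 * \<delta> / 8)))) \<longlonglongrightarrow> (6 * C_T * C_R) * 0"
      using constants(4) by (intro tendsto_mult tendsto_const) real_asymp
    have eq: "6 * C_T * C_R * real n powr (- 1 / 2 + \<delta> / 8) * sqrt (ln (real n)) *
        (real n powr ((1 - \<delta>) / 2) * (ln (real n) / ln 2 + 3)) =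
        (6 * C_T * C_R) * (sqrt (ln (real n)) * (ln (real n) / ln 2 + 3) * real n powr (- (3 * \<delta> / 8)))" for n :: nat
    proof -
      have "real n powr (- (3 * \<delta> / 8)) = real n powr (- 1 / 2 + \<delta> / 8) * real n powr ((1 - \<delta>) / 2)"
        unfolding powr_add[symmetric] by (rule arg_cong[where f = "(powr) (real n)"]) (simp add: field_simps)
      then show ?thesis by (simp only: mult_ac)
    qed
    show ?thesis
      unfolding \<epsilon>_def eq using tendsto_add[OF 1 2] unfolding mult_zero_right add_0_right .
  qed
  define F where "F n f\<^sub>0 M' = (\<integral>Y. measure (posterior n (spike_slab n (p n) (\<pi> n)) Y)
              {\<beta> \<in> space (\<Pi>\<^sub>M i\<in>idx_upto n. borel).
                 (SUP x\<in>{0..1}. rate n (t x) * \<bar>haar_sum n \<beta> x - f\<^sub>0 x\<bar>) > M'}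
         \<partial>data_law n (haar_coeff f\<^sub>0))" for n f\<^sub>0 M'
  have F0: "0 \<le> F n f\<^sub>0 M'" for n f\<^sub>0 M' unfolding F_def by (rule Bochner_Integration.integral_nonneg) simp
  have main: "F n f\<^sub>0 M' \<le> \<epsilon> n"
    if n: "n \<ge> 3" and nR: "1 / sqrt (real n) \<le> R" and f: "f\<^sub>0 \<in> local_holder t M \<eta>" and M': "M\<^sub>0 \<le> M'"
    for n f\<^sub>0 M'
  proof -
    define c where "c = haar_coeff f\<^sub>0"
    define P where "P = spike_slab n (p n) (\<pi> n)"
    have n1: "n \<ge> 1" using n by simp
    note S = prior[rule_format, OF n1]
    note S' = S[unfolded spike_slab_assumption_def]
    have fin: "finite (idx_upto n)" by (rule finite_idx_upto[OF n1])
    have hol: "\<bar>f\<^sub>0 y - f\<^sub>0 x\<bar> \<le> H * \<bar>y - x\<bar> powr t x" if "x \<in> {0..1}" "y \<in> {0..1}" for x y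
      unfolding H_def
      by (rule local_holder_uniform[OF f that]) (use Mb(2) e t that in \<open>auto intro: order_trans[OF less_imp_le[OF t(1)]]\<close>)
    have int: "set_integrable lborel {0..1} f\<^sub>0"
      by (rule set_integrable_holder[OF hol]) (use t in \<open>auto intro: less_le_trans\<close>)
    have sP: "sets P = sets (\<Pi>\<^sub>M i\<in>idx_upto n. borel)"
      unfolding P_def
      by (rule nn_integral_spike_slab(1)[OF fin, where F = "\<lambda>_ _. 0"]) (use S' in auto)
    define B where "B i = (if \<bar>c i\<bar> \<le> a * r n then - {0} else {y. A * r n < \<bar>y - c i\<bar>})" for i
    have Bm: "B i \<in> sets borel" for i unfolding B_def by (cases "\<bar>c i\<bar> \<le> a * r n") auto
    define E where "E i = {\<beta> \<in> space (\<Pi>\<^sub>M i\<in>idx_upto n. borel). \<beta> i \<in> B i}" for i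
    define \<epsilon>i where "\<epsilon>i i = sqrt 2 * real n powr (- 9 / 4) + (K * real n powr (- 2) +
        6 * (C_T * C_R * \<omega> n (fst i)) * real n powr (- 1 / 2 + 7 / 2 * a) * sqrt (ln (real n)))" for i :: "int \<times> nat"
    have ln1: "1 \<le> ln (real n)" by (rule ln_ge_1[OF n])
    have idx: "i \<in> haar_idx" "-1 \<le> fst i" "fst i \<le> L_max n" if "i \<in> idx_upto n" for i
      using that by (auto simp: idx_upto_def haar_idx_def)
    have \<omega>: "0 < \<omega> n l" "\<omega> n l \<le> real n powr ((1 - \<delta>) / 2) * 2 powr (- real_of_int l)"
      if "-1 \<le> l" "l \<le> L_max n" for l
      using S' that by blast+
    have "\<forall>i\<in>idx_upto n. \<exists>h :: real \<Rightarrow> real. h \<in> borel_measurable borel \<and> (\<forall>y. 0 \<le> h y) \<and>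
        (\<forall>Y. emeasure (posterior n P Y) (E i) \<le> ennreal (h (Y i))) \<and>
        (\<integral>\<^sup>+e. ennreal (std_normal_density e) * ennreal (h (c i + e / sqrt (real n))) \<partial>lborel) \<le> ennreal (\<epsilon>i i)"
      (is "\<forall>i\<in>_. \<exists>h. ?Q i h")
    proof
      fix i assume i: "i \<in> idx_upto n"
      obtain l k where lk: "i = (l, k)" by (cases i)
      \<comment> \<open>The slab densities are bounded below only on \<open>[-R, R]\<close>, so
        \<open>R_large\<close> has to place the true coefficient there.\<close>
      have cR: "\<bar>c i\<bar> \<le> R" using R_large f idx(1)[OF i] by (auto simp: c_def)
      show "\<exists>h. ?Q i h"
        by (rule posterior_coordinate_risk[OF n S constants(1,2,6,7,3) a(1,2) i[unfolded lk] cR nR])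
          (auto simp: lk P_def E_def B_def A_def r_def \<epsilon>i_def K_def)
    qed
    from bchoice[OF this] obtain h where h': "\<forall>i\<in>idx_upto n. ?Q i (h i)" ..
    then have h:
      "\<And>i. i \<in> idx_upto n \<Longrightarrow> h i \<in> borel_measurable borel"
      "\<And>i y. i \<in> idx_upto n \<Longrightarrow> 0 \<le> h i y"
      "\<And>i Y. i \<in> idx_upto n \<Longrightarrow> emeasure (posterior n P Y) (E i) \<le> ennreal (h i (Y i))"
      "\<And>i. i \<in> idx_upto n \<Longrightarrow> (\<integral>\<^sup>+e. ennreal (std_normal_density e) * ennreal (h i (c i + e / sqrt (real n))) \<partial>lborel) \<le> ennreal (\<epsilon>i i)"
      by blast+
    let ?bad = "{\<beta> \<in> space (\<Pi>\<^sub>M i\<in>idx_upto n. borel).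
                 (SUP x\<in>{0..1}. rate n (t x) * \<bar>haar_sum n \<beta> x - f\<^sub>0 x\<bar>) > M'}"
    \<comment> \<open>If no coordinate fails, the deterministic bound holds at every
      \<open>x\<close> with the same constant \<open>M\<^sub>0\<close>, and so does the bound on the
      supremum.\<close>
    have sub: "?bad \<subseteq> (\<Union>i\<in>idx_upto n. E i)"
    proof
      fix \<beta> assume \<beta>: "\<beta> \<in> ?bad"
      show "\<beta> \<in> (\<Union>i\<in>idx_upto n. E i)"
      proof (rule ccontr)
        assume "\<beta> \<notin> (\<Union>i\<in>idx_upto n. E i)"
        then have good: "\<beta> i \<notin> B i" if "i \<in> idx_upto n" for i using \<beta> that by (auto simp: E_def)
        have "rate n (t x) * \<bar>haar_sum n \<beta> x - f\<^sub>0 x\<bar> \<le> M\<^sub>0" if x: "x \<in> {0..1}" for x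
          unfolding M\<^sub>0_def
        proof (rule haar_error_bound[OF n x t(1) _ _ int H hol[OF x] a(1) A(2)])
          fix i assume i: "i \<in> idx_upto n"
          show "\<bar>haar_coeff f\<^sub>0 i\<bar> \<le> a * sqrt (ln (real n) / real n) \<Longrightarrow> \<beta> i = 0"
            using good[OF i] by (simp add: B_def c_def r_def)
          show "a * sqrt (ln (real n) / real n) < \<bar>haar_coeff f\<^sub>0 i\<bar> \<Longrightarrow>
              \<bar>\<beta> i - haar_coeff f\<^sub>0 i\<bar> \<le> A * sqrt (ln (real n) / real n)"
            using good[OF i] by (simp add: B_def c_def r_def)
        qed (use t x in auto)
        then have "(SUP x\<in>{0..1}. rate n (t x) * \<bar>haar_sum n \<beta> x - f\<^sub>0 x\<bar>) \<le> M\<^sub>0"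
          by (intro cSUP_least) auto
        then show False using \<beta> M' by simp
      qed
    qed
    \<comment> \<open>Measurability is checked for the sets \<open>E i\<close> only: monotonicity of
      \<open>emeasure\<close> asks for it on the larger set, and a set outside the sigma-algebra has
      measure 0.\<close>
    have bound: "measure (posterior n P Y) ?bad \<le> (\<Sum>i\<in>idx_upto n. h i (Y i))" for Y
    proof -
      have Es: "E i \<in> sets (posterior n P Y)" if i: "i \<in> idx_upto n" for i
        unfolding posterior_def sets_density sP E_def using i Bm by measurable
      have "emeasure (posterior n P Y) ?bad \<le> emeasure (posterior n P Y) (\<Union>i\<in>idx_upto n. E i)"
        by (rule emeasure_mono[OF sub]) (use Es fin in auto)
      also have "\<dots> \<le> (\<Sum>i\<in>idx_upto n. emeasure (posterior n P Y) (E i))"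
        by (rule emeasure_subadditive_finite) (use Es fin in auto)
      also have "\<dots> \<le> (\<Sum>i\<in>idx_upto n. ennreal (h i (Y i)))"
        by (intro sum_mono h(3))
      also have "\<dots> = ennreal (\<Sum>i\<in>idx_upto n. h i (Y i))"
        by (rule sum_ennreal) (use h in auto)
      finally show ?thesis unfolding measure_def
        by (rule enn2real_leI[rotated]) (intro sum_nonneg h(2))
    qed
    have \<epsilon>i0: "0 \<le> \<epsilon>i i" if "i \<in> idx_upto n" for i
      unfolding \<epsilon>i_def using K ln1 constants \<omega>(1)[OF idx(2,3)[OF that]] by simp
    have sets_data: "sets (data_law n c) = sets (\<Pi>\<^sub>M i\<in>haar_idx. borel)"
      by (simp add: data_law_def)
    have hm: "(\<lambda>Y. h i (Y i)) \<in> borel_measurable (data_law n c)" if i: "i \<in> idx_upto n" for i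
      unfolding measurable_cong_sets[OF sets_data refl]
      using h(1)[OF i] idx(1)[OF i] by measurable
    have "F n f\<^sub>0 M' \<le> (\<Sum>i\<in>idx_upto n. \<epsilon>i i)"
      unfolding F_def P_def[symmetric] c_def[symmetric]
    proof (rule integral_le_of_nn_integral_le[OF _ _ bound])
      show "(\<lambda>Y. \<Sum>i\<in>idx_upto n. h i (Y i)) \<in> borel_measurable (data_law n c)"
        by (rule borel_measurable_sum[OF hm])
      show "0 \<le> (\<Sum>i\<in>idx_upto n. h i (Y i))" for Y by (intro sum_nonneg h(2))
      show "0 \<le> (\<Sum>i\<in>idx_upto n. \<epsilon>i i)" by (intro sum_nonneg \<epsilon>i0)
      have "(\<integral>\<^sup>+Y. ennreal (\<Sum>i\<in>idx_upto n. h i (Y i)) \<partial>data_law n c) =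
          (\<integral>\<^sup>+Y. (\<Sum>i\<in>idx_upto n. ennreal (h i (Y i))) \<partial>data_law n c)"
        by (rule nn_integral_cong, rule sum_ennreal[symmetric]) (use h in auto)
      also have "\<dots> = (\<Sum>i\<in>idx_upto n. \<integral>\<^sup>+Y. ennreal (h i (Y i)) \<partial>data_law n c)"
        by (rule nn_integral_sum) (rule measurable_compose[OF hm measurable_ennreal])
      also have "\<dots> \<le> (\<Sum>i\<in>idx_upto n. ennreal (\<epsilon>i i))"
      proof (rule sum_mono)
        fix i assume i: "i \<in> idx_upto n"
        have "(\<lambda>y. ennreal (h i y)) \<in> borel_measurable borel" using h(1)[OF i] by measurable
        from nn_integral_data_law[OF idx(1)[OF i] this, of n c] h(4)[OF i]
        show "(\<integral>\<^sup>+Y. ennreal (h i (Y i)) \<partial>data_law n c) \<le> ennreal (\<epsilon>i i)" by simp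
      qed
      also have "\<dots> = ennreal (\<Sum>i\<in>idx_upto n. \<epsilon>i i)" by (rule sum_ennreal) (rule \<epsilon>i0)
      finally show "(\<integral>\<^sup>+Y. ennreal (\<Sum>i\<in>idx_upto n. h i (Y i)) \<partial>data_law n c) \<le>
          ennreal (\<Sum>i\<in>idx_upto n. \<epsilon>i i)" .
    qed
    also have "(\<Sum>i\<in>idx_upto n. \<epsilon>i i) = real (card (idx_upto n)) *
        (sqrt 2 * real n powr (- 9 / 4) + K * real n powr (- 2)) +
        6 * C_T * C_R * real n powr (- 1 / 2 + 7 / 2 * a) * sqrt (ln (real n)) * (\<Sum>i\<in>idx_upto n. \<omega> n (fst i))"
    proof -
      have "\<epsilon>i i = (sqrt 2 * real n powr (- 9 / 4) + K * real n powr (- 2)) +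
          (6 * C_T * C_R * real n powr (- 1 / 2 + 7 / 2 * a) * sqrt (ln (real n))) * \<omega> n (fst i)" for i
        unfolding \<epsilon>i_def by simp
      then show ?thesis by (simp add: sum.distrib sum_distrib_left[symmetric] distrib_left)
    qed
    also have "\<dots> \<le> \<epsilon> n"
      unfolding \<epsilon>_def
    proof (intro add_mono mult_mono)
      show "real (card (idx_upto n)) \<le> 2 * real n" by (rule card_idx_upto_le[OF n1])
      show "real n powr (- 1 / 2 + 7 / 2 * a) \<le> real n powr (- 1 / 2 + \<delta> / 8)"
        using n a by (intro powr_mono) auto
      show "(\<Sum>i\<in>idx_upto n. \<omega> n (fst i)) \<le> real n powr ((1 - \<delta>) / 2) * (ln (real n) / ln 2 + 3)"
        by (rule sum_weights_le[OF n1]) (use \<omega> in auto)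
      show "0 \<le> (\<Sum>i\<in>idx_upto n. \<omega> n (fst i))"
        by (rule sum_nonneg) (use \<omega>(1)[OF idx(2,3)] in \<open>auto intro: less_imp_le\<close>)
    qed (use constants K ln1 in auto)
    finally show ?thesis .
  qed
  \<comment> \<open>Suprema of reals are informative only for nonempty bounded families. The zero
    function provides nonemptiness, and the bound \<open>main\<close> provides boundedness.\<close>
  have zero: "(\<lambda>x. 0) \<in> local_holder t M \<eta>"
    using Mb by (auto simp: local_holder_def intro: order_trans[OF less_imp_le[OF Mb(1)]])
  \<comment> \<open>The second condition lets the interval of length \<open>1 / sqrt n\<close> next
    to a true coefficient fit into \<open>[-R, R]\<close>.\<close>
  have ev: "\<forall>\<^sub>F n in sequentially. n \<ge> 3 \<and> 1 / sqrt (real n) \<le> R"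
  proof -
    have "(\<lambda>n. 1 / sqrt (real n)) \<longlonglongrightarrow> 0" by real_asymp
    then have "\<forall>\<^sub>F n in sequentially. 1 / sqrt (real n) < R"
      using constants(5) by (rule order_tendstoD)
    with eventually_ge_at_top[of 3] show ?thesis by eventually_elim auto
  qed
  have "(\<lambda>n. SUP f\<^sub>0\<in>local_holder t M \<eta>. F n f\<^sub>0 M') \<longlonglongrightarrow> 0" if M': "M\<^sub>0 \<le> M'" for M'
  proof (rule tendsto_sandwich[OF _ _ tendsto_const \<epsilon>_lim])
    show "\<forall>\<^sub>F n in sequentially. (SUP f\<^sub>0\<in>local_holder t M \<eta>. F n f\<^sub>0 M') \<le> \<epsilon> n"
      using ev by eventually_elim (use zero main M' in \<open>auto intro!: cSUP_least\<close>)
    show "\<forall>\<^sub>F n in sequentially. 0 \<le> (SUP f\<^sub>0\<in>local_holder t M \<eta>. F n f\<^sub>0 M')"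
      using ev
    proof eventually_elim
      case (elim n)
      have "bdd_above ((\<lambda>f\<^sub>0. F n f\<^sub>0 M') ` local_holder t M \<eta>)"
        using main[of n _ M'] elim M' by (intro bdd_aboveI2[of _ _ "\<epsilon> n"]) auto
      from cSUP_upper[OF zero this] show ?case using F0 order_trans by blast
    qed
  qed
  then show ?thesis unfolding F_def using M0 by blast
qed

end
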